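(* Let $\mathfrak g$ be a real solvable Lie algebra with nilradical $\mathfrak h$ of codimension $2$. The following are equivalent: (i) $\mathfrak g$ admits a generalized Kähler structure $(J_\pm,\langle\cdot,\cdot\rangle)$ such that $J_+\mathfrak h=\mathfrak h$ and $J_-\mathfrak h=\mathfrak h$; (ii) $\mathfrak g$ admits a Kähler structure $(J_+,\langle\cdot,\cdot\rangle)$ such that $J_+\mathfrak h=\mathfrak h$.
   Context: All Lie algebras are real and finite-dimensional. The nilradical is the maximal nilpotent ideal. A Hermitian structure on $\mathfrak g$ is a pair $(J,\langle\cdot,\cdot\rangle)$ with $J^2=-\mathrm{Id}$, $J$ integrable ($[X,Y]+J([JX,Y]+[X,JY])-[JX,JY]=0$ for all $X,Y$), and $\langle\cdot,\cdot\rangle$ an inner product with $\langle JX,JY\rangle=\langle X,Y\rangle$. Fundamental form $\omega=\langle J\cdot,\cdot\rangle$; $d$ is the Chevalley–Eilenberg differential. It is Kähler if $d\omega=0$. Bismut torsion: $c(X,Y,Z)=d\omega(JX,JY,JZ)$. A generalized Kähler structure $(J_+,J_-,\langle\cdot,\cdot\rangle)=(J_\pm,\langle\cdot,\cdot\rangle)$ is a pair of Hermitian structures $(J_+,\langle\cdot,\cdot\rangle)$, $(J_-,\langle\cdot,\cdot\rangle)$ with the same inner product whose Bismut torsions satisfy $c_+=-c_-$ and $dc_+=0$. *)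

theory Defs
  imports "HOL-Analysis.Analysis"
begin

section \<open>Real Lie algebras\<close>

text \<open>A Lie algebra is a real vector space type together with a bracket on it.\<close>

definition lie_bracket :: "('a::real_vector \<Rightarrow> 'a \<Rightarrow> 'a) \<Rightarrow> bool" where
  "lie_bracket br \<longleftrightarrow> bilinear br \<and> (\<forall>x. br x x = 0) \<and>
     (\<forall>x y z. br x (br y z) + br y (br z x) + br z (br x y) = 0)"

definition bracket_span :: "('a::real_vector \<Rightarrow> 'a \<Rightarrow> 'a) \<Rightarrow> 'a set \<Rightarrow> 'a set \<Rightarrow> 'a set" where
  "bracket_span br A B = span {br x y | x y. x \<in> A \<and> y \<in> B}"

primrec derived_series :: "('a::real_vector \<Rightarrow> 'a \<Rightarrow> 'a) \<Rightarrow> 'a set \<Rightarrow> nat \<Rightarrow> 'a set" where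
  "derived_series br A 0 = A"
| "derived_series br A (Suc n) =
     bracket_span br (derived_series br A n) (derived_series br A n)"

primrec lower_central_series :: "('a::real_vector \<Rightarrow> 'a \<Rightarrow> 'a) \<Rightarrow> 'a set \<Rightarrow> nat \<Rightarrow> 'a set" where
  "lower_central_series br A 0 = A"
| "lower_central_series br A (Suc n) = bracket_span br A (lower_central_series br A n)"

definition solvable_on :: "('a::real_vector \<Rightarrow> 'a \<Rightarrow> 'a) \<Rightarrow> 'a set \<Rightarrow> bool" where
  "solvable_on br A \<longleftrightarrow> (\<exists>n. derived_series br A n = {0})"

definition nilpotent_on :: "('a::real_vector \<Rightarrow> 'a \<Rightarrow> 'a) \<Rightarrow> 'a set \<Rightarrow> bool" where
  "nilpotent_on br A \<longleftrightarrow> (\<exists>n. lower_central_series br A n = {0})"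

definition lie_ideal :: "('a::real_vector \<Rightarrow> 'a \<Rightarrow> 'a) \<Rightarrow> 'a set \<Rightarrow> bool" where
  "lie_ideal br I \<longleftrightarrow> subspace I \<and> (\<forall>x. \<forall>y\<in>I. br x y \<in> I)"

definition is_nilradical :: "('a::real_vector \<Rightarrow> 'a \<Rightarrow> 'a) \<Rightarrow> 'a set \<Rightarrow> bool" where
  "is_nilradical br H \<longleftrightarrow> lie_ideal br H \<and> nilpotent_on br H \<and>
     (\<forall>I. lie_ideal br I \<and> nilpotent_on br I \<longrightarrow> I \<subseteq> H)"

section \<open>The Chevalley--Eilenberg differential\<close>

text \<open>A \<open>k\<close>-form is encoded as a function on lists of vectors, of which only the values on
  lists of length \<open>k\<close> matter.  The differential is the one with trivial real coefficients,
  \<open>(d \<alpha>)(X_0, ..., X_k) = (\<Sum>i<j. (-1)^(i+j) * \<alpha>([X_i, X_j], X_0, ..., X_k))\<close> with \<open>X_i\<close>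
  and \<open>X_j\<close> omitted from the tail.\<close>

definition ce_diff ::
  "('a \<Rightarrow> 'a \<Rightarrow> 'a) \<Rightarrow> ('a list \<Rightarrow> real) \<Rightarrow> 'a list \<Rightarrow> real" where
  "ce_diff br \<alpha> xs =
     (\<Sum>j<length xs. \<Sum>i<j.
        (-1) ^ (i + j) * \<alpha> (br (xs ! i) (xs ! j) # nths xs (- {i, j})))"

lemma ce_diff_2_form:
  "ce_diff br \<alpha> [x, y, z] = - \<alpha> [br x y, z] + \<alpha> [br x z, y] - \<alpha> [br y z, x]"
  by (simp add: ce_diff_def nths_Cons numeral_eq_Suc)

lemma ce_diff_3_form:
  "ce_diff br \<alpha> [x, y, z, w] =
     - \<alpha> [br x y, z, w] + \<alpha> [br x z, y, w] - \<alpha> [br x w, y, z]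
     - \<alpha> [br y z, x, w] + \<alpha> [br y w, x, z] - \<alpha> [br z w, x, y]"
  by (simp add: ce_diff_def nths_Cons numeral_eq_Suc)

section \<open>Hermitian, Kaehler and generalized Kaehler structures\<close>

definition inner_product :: "('a::real_vector \<Rightarrow> 'a \<Rightarrow> real) \<Rightarrow> bool" where
  "inner_product g \<longleftrightarrow> bilinear g \<and> (\<forall>x y. g x y = g y x) \<and> (\<forall>x. x \<noteq> 0 \<longrightarrow> g x x > 0)"

definition integrable_complex_structure ::
  "('a::real_vector \<Rightarrow> 'a \<Rightarrow> 'a) \<Rightarrow> ('a \<Rightarrow> 'a) \<Rightarrow> bool" where
  "integrable_complex_structure br J \<longleftrightarrow> linear J \<and> (\<forall>x. J (J x) = - x) \<and>
     (\<forall>x y. br x y + J (br (J x) y + br x (J y)) - br (J x) (J y) = 0)"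

definition hermitian_structure ::
  "('a::real_vector \<Rightarrow> 'a \<Rightarrow> 'a) \<Rightarrow> ('a \<Rightarrow> 'a) \<Rightarrow> ('a \<Rightarrow> 'a \<Rightarrow> real) \<Rightarrow> bool" where
  "hermitian_structure br J g \<longleftrightarrow> integrable_complex_structure br J \<and> inner_product g \<and>
     (\<forall>x y. g (J x) (J y) = g x y)"

definition fundamental_form ::
  "('a \<Rightarrow> 'a) \<Rightarrow> ('a \<Rightarrow> 'a \<Rightarrow> real) \<Rightarrow> 'a list \<Rightarrow> real" where
  "fundamental_form J g xs = (case xs of [x, y] \<Rightarrow> g (J x) y | _ \<Rightarrow> 0)"

definition bismut_torsion ::
  "('a \<Rightarrow> 'a \<Rightarrow> 'a) \<Rightarrow> ('a \<Rightarrow> 'a) \<Rightarrow> ('a \<Rightarrow> 'a \<Rightarrow> real) \<Rightarrow> 'a list \<Rightarrow> real" where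
  "bismut_torsion br J g xs = ce_diff br (fundamental_form J g) (map J xs)"

definition kahler_structure ::
  "('a::real_vector \<Rightarrow> 'a \<Rightarrow> 'a) \<Rightarrow> ('a \<Rightarrow> 'a) \<Rightarrow> ('a \<Rightarrow> 'a \<Rightarrow> real) \<Rightarrow> bool" where
  "kahler_structure br J g \<longleftrightarrow> hermitian_structure br J g \<and>
     (\<forall>x y z. ce_diff br (fundamental_form J g) [x, y, z] = 0)"

definition generalized_kahler_structure ::
  "('a::real_vector \<Rightarrow> 'a \<Rightarrow> 'a) \<Rightarrow> ('a \<Rightarrow> 'a) \<Rightarrow> ('a \<Rightarrow> 'a) \<Rightarrow> ('a \<Rightarrow> 'a \<Rightarrow> real) \<Rightarrow> bool" where
  "generalized_kahler_structure br Jp Jm g \<longleftrightarrow>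
     hermitian_structure br Jp g \<and> hermitian_structure br Jm g \<and>
     (\<forall>x y z. bismut_torsion br Jp g [x, y, z] = - bismut_torsion br Jm g [x, y, z]) \<and>
     (\<forall>x y z w. ce_diff br (bismut_torsion br Jp g) [x, y, z, w] = 0)"

end

theory Submission
  imports Defs
begin

text \<open>A Kaehler structure is generalized Kaehler with \<open>J\<^sub>- = J\<^sub>+\<close> and zero torsion.  Conversely, let
  \<open>(J\<^sub>\<plusminus>, g)\<close> be a generalized Kaehler structure preserving the nilradical \<open>\<hh>\<close>; the Hermitian
  structure \<open>(J\<^sub>+, g)\<close> turns out to be Kaehler already.

  \<^bold>\<open>The nilradical is abelian.\<close>  Since \<open>\<hh>\<close> is invariant under both complex structures, it inherits a
  generalized Kaehler structure, so it suffices that a nilpotent generalized Kaehler Lie algebra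
  \<open>\<nn>\<close> is abelian.  The Courant bracket twisted by the torsion makes \<open>\<qq> = \<nn> \<oplus> \<nn>\<^sup>*\<close> a nilpotent
  quadratic Lie algebra, and \<open>J\<^sub>\<plusminus>\<close> become two commuting, orthogonal, integrable complex structures
  \<open>J\<close>, \<open>K\<close> of \<open>\<qq>\<close> whose product has eigenspaces \<open>V\<^sub>+\<close>, \<open>V\<^sub>-\<close>, on which the pairing is
  definite with opposite signs.  For \<open>u \<in> V\<^sub>+\<close> and \<open>v \<in> V\<^sub>-\<close> let \<open>\<nabla>\<^sub>u v\<close> be the \<open>V\<^sub>-\<close>-part of
  \<open>[u, v]\<close>; this is a Bismut connection, and \<open>D\<^sub>u = \<nabla>\<^sub>u - J \<nabla>\<^sub>J\<^sub>u\<close> is twice its (1,0)-part.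
  Three facts force \<open>\<nabla> = 0\<close>.  Nilpotency of \<open>\<qq>\<close> makes all long products of operators \<open>D\<^sub>u\<close> vanish
  and kills the traces that measure \<open>\<Sum> [e, J e]\<close>, where \<open>e\<close> runs over an orthonormal basis of
  \<open>V\<^sub>+\<close> (\<open>trace_zero\<close>).  The Jacobi identity, paired with itself and summed over that basis, then
  says \<open>\<Sum> |D\<^sub>e v|\<^sup>2 = \<Sum> |D\<^sub>e\<^sup>* v|\<^sup>2\<close> for each \<open>v \<in> V\<^sub>-\<close> (\<open>mixed_square_sum\<close>), where the adjoint is
  \<open>D\<^sub>u\<^sup>* = - \<nabla>\<^sub>u - J \<nabla>\<^sub>J\<^sub>u\<close>.  So a vector killed by all \<open>D\<^sub>u\<close> is killed by all \<open>D\<^sub>u\<^sup>*\<close> and hence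
  by \<open>\<nabla>\<close>; as the values of the longest nonvanishing products of the \<open>D\<^sub>u\<close> are killed by all \<open>D\<^sub>u\<close>
  and so orthogonal to the range of each \<open>D\<^sub>u\<close>, they are zero after all, and an induction gives
  \<open>D = 0\<close> and \<open>\<nabla> = 0\<close> (\<open>mixed_bracket_half\<close>).
  Exchanging the roles of \<open>V\<^sub>+\<close> and \<open>V\<^sub>-\<close> gives \<open>[V\<^sub>+, V\<^sub>-] = 0\<close>.  Then all \<open>ad x\<close> are skew for
  a positive definite form and nilpotent, hence zero (\<open>quadratic_gk_pair.nilpotent_imp_abelian\<close>).

  \<^bold>\<open>The complement.\<close>  Let \<open>e\<close>, \<open>f = J\<^sub>+ e\<close> be an orthonormal basis of \<open>\<hh>\<^sup>\<bottom>\<close>, so that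
  \<open>J\<^sub>- e = \<plusminus> f\<close>.  For both structures the torsion sends \<open>(e, f, y)\<close> with \<open>y \<in> \<hh>\<close> to
  \<open>- g([e, f], y)\<close>; as the torsions are opposite, \<open>w = [e, f]\<close> is orthogonal to \<open>\<hh>\<close>.  If
  \<open>w \<noteq> 0\<close>, some \<open>u \<in> \<hh>\<^sup>\<bottom>\<close> satisfies \<open>[u, w] = l w\<close> with \<open>l \<noteq> 0\<close>; then \<open>ad w\<close> is nilpotent on
  \<open>\<hh>\<close> and \<open>\<hh> + \<real>w\<close> is a nilpotent ideal larger than the nilradical (\<open>mem_nilradical\<close>).
  So \<open>[e, f] = 0\<close>.

  \<^bold>\<open>The torsion vanishes.\<close>  Write \<open>a = ad e\<close>, \<open>b = ad f\<close> on \<open>\<hh>\<close> and \<open>J = J\<^sub>+\<close>.  Summing \<open>dc(e, f, y, J y) = 0\<close> over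
  an orthonormal basis of \<open>\<hh>\<close> gives \<open>tr((aJ)\<^sup>2) - |aJ|\<^sup>2 + tr((bJ)\<^sup>2) - |bJ|\<^sup>2 = 0\<close>.  Each difference
  is minus half the squared norm of the skew part \<open>M - M\<^sup>T\<close> of \<open>M = aJ\<close> or \<open>M = bJ\<close>
  (\<open>trace_square_defect\<close>), so \<open>aJ\<close> and \<open>bJ\<close> are symmetric, which is exactly the vanishing of the
  remaining components of \<open>c\<close>; hence \<open>d\<omega> = 0\<close> (\<open>kahler_of_codim_2\<close>).\<close>

section \<open>Orthonormal families, traces and nilpotent operators\<close>

definition orthonormal :: "('a::real_vector \<Rightarrow> 'a \<Rightarrow> real) \<Rightarrow> 'a set \<Rightarrow> bool" where
  "orthonormal g E \<longleftrightarrow> finite E \<and> (\<forall>x\<in>E. \<forall>y\<in>E. g x y = (if x = y then 1 else 0))"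

lemma inner_product_bilinear: "inner_product g \<Longrightarrow> bilinear g"
  and inner_product_sym: "inner_product g \<Longrightarrow> g x y = g y x"
  and inner_product_pos: "inner_product g \<Longrightarrow> x \<noteq> 0 \<Longrightarrow> g x x > 0"
  by (auto simp: inner_product_def)

lemma inner_product_nonneg: "inner_product g \<Longrightarrow> 0 \<le> g x x"
  by (cases "x = 0") (auto simp: inner_product_bilinear bilinear_lzero dest: inner_product_pos[of g x])

lemma inner_product_eq_0: "inner_product g \<Longrightarrow> g x x = 0 \<longleftrightarrow> x = 0"
  by (metis bilinear_lzero inner_product_bilinear inner_product_pos less_irrefl)

lemma inner_product_nondegenerate:
  assumes "inner_product g" and "\<And>z. g x z = g y z"
  shows "x = y"
  using assms inner_product_eq_0[OF assms(1), of "x - y"]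
  by (simp add: bilinear_lsub[OF inner_product_bilinear])

lemma linear_form_left: "bilinear g \<Longrightarrow> linear (\<lambda>x. g x y)"
  and linear_form_right: "bilinear g \<Longrightarrow> linear (g x)"
  by (auto simp: bilinear_def)

lemma orthonormal_expansion:
  assumes g: "bilinear g" and E: "orthonormal g E" and x: "x \<in> span E"
  shows "x = (\<Sum>e\<in>E. g x e *\<^sub>R e)"
  using x
proof (induction rule: span_induct_alt)
  case base
  show ?case by (simp add: bilinear_lzero[OF g])
next
  case (step c e y)
  have fin: "finite E" and "\<And>f. f \<in> E \<Longrightarrow> g e f = (if e = f then 1 else 0)"
    using E step(1) by (auto simp: orthonormal_def)
  then have "(\<Sum>f\<in>E. g e f *\<^sub>R f) = (\<Sum>f\<in>E. if e = f then f else 0)"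
    by (intro sum.cong) auto
  also have "\<dots> = e" using fin step(1) by simp
  finally have e: "(\<Sum>f\<in>E. g e f *\<^sub>R f) = e" .
  have "(\<Sum>f\<in>E. g (c *\<^sub>R e + y) f *\<^sub>R f) = c *\<^sub>R (\<Sum>f\<in>E. g e f *\<^sub>R f) + (\<Sum>f\<in>E. g y f *\<^sub>R f)"
    by (simp add: bilinear_ladd[OF g] bilinear_lmul[OF g] scaleR_left_distrib sum.distrib scaleR_sum_right)
  then show ?case using step(2) e by simp
qed

lemma orthonormal_expansion_linear:
  assumes "bilinear g" and "orthonormal g E" and "x \<in> span E" and "linear f"
  shows "f x = (\<Sum>e\<in>E. g x e *\<^sub>R f e)"
proof -
  have "f x = f (\<Sum>e\<in>E. g x e *\<^sub>R e)"
    using orthonormal_expansion[OF assms(1-3)] by simp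
  also have "\<dots> = (\<Sum>e\<in>E. g x e *\<^sub>R f e)"
    by (simp add: linear_sum[OF assms(4)] linear_scale[OF assms(4)])
  finally show ?thesis .
qed

lemma parseval:
  assumes g: "inner_product g" and "orthonormal g E" and "x \<in> span E"
  shows "g x y = (\<Sum>e\<in>E. g x e * g y e)"
  using orthonormal_expansion_linear[OF inner_product_bilinear[OF g] assms(2,3)
      linear_form_left[OF inner_product_bilinear[OF g], of y]]
  by (simp add: inner_product_sym[OF g, of _ y])

text \<open>One step of Gram--Schmidt for each added vector.\<close>

lemma orthonormal_extend:
  assumes g: "inner_product g" and E: "orthonormal g E" and B: "finite B"
  shows "\<exists>F. E \<subseteq> F \<and> orthonormal g F \<and> span F = span (E \<union> B)"
  using B
proof (induction B)
  case empty
  then show ?case using E by auto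
next
  case (insert b B)
  then obtain F where F: "E \<subseteq> F" "orthonormal g F" "span F = span (E \<union> B)" by auto
  note gb = inner_product_bilinear[OF g]
  have ins: "span (E \<union> insert b B) = span (insert b F)"
    using F(3) by (metis Un_insert_right span_insert)
  show ?case
  proof (cases "b \<in> span F")
    case True
    then show ?thesis using F ins by (metis span_redundant)
  next
    case False
    define p where "p = (\<Sum>e\<in>F. g b e *\<^sub>R e)"
    define y where "y = b - p"
    define u where "u = (1 / sqrt (g y y)) *\<^sub>R y"
    have finF: "finite F" using F(2) by (simp add: orthonormal_def)
    have p: "p \<in> span F" unfolding p_def by (intro span_sum span_scale span_base)
    have "y \<noteq> 0" using False p by (auto simp: y_def)
    then have pos: "g y y > 0" by (rule inner_product_pos[OF g])
    have perp: "g y f = 0" if f: "f \<in> F" for f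
    proof -
      have "g p f = (\<Sum>e\<in>F. g b e * g e f)"
        unfolding p_def by (simp add: linear_sum[OF linear_form_left[OF gb]] bilinear_lmul[OF gb])
      also have "\<dots> = (\<Sum>e\<in>F. if e = f then g b e else 0)"
        using F(2) f by (intro sum.cong) (auto simp: orthonormal_def)
      also have "\<dots> = g b f" using finF f by simp
      finally show ?thesis by (simp add: y_def bilinear_lsub[OF gb])
    qed
    have uu: "g u u = 1" using pos
      by (simp add: u_def bilinear_lmul[OF gb] bilinear_rmul[OF gb])
    have uf: "g u f = 0" "g f u = 0" if "f \<in> F" for f
      using perp[OF that] inner_product_sym[OF g, of f u]
      by (simp_all add: u_def bilinear_lmul[OF gb])
    have on: "orthonormal g (insert u F)"
      using F(2) uu uf by (auto simp: orthonormal_def)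
    have b: "b = sqrt (g y y) *\<^sub>R u + p" using pos by (simp add: u_def y_def)
    have "b \<in> span (insert u F)"
      unfolding b using p span_mono[of F "insert u F"]
      by (intro span_add span_scale) (auto intro: span_base)
    moreover have "u \<in> span (insert b F)"
      unfolding u_def y_def using p span_mono[of F "insert b F"]
      by (intro span_scale span_diff) (auto intro: span_base)
    ultimately have "span (insert u F) = span (insert b F)"
      by (intro span_eq[THEN iffD2]) (auto intro: span_base)
    then show ?thesis using on F(1) ins by (intro exI[of _ "insert u F"]) auto
  qed
qed

lemma orthonormal_basis_subspace:
  assumes g: "inner_product g" and S: "subspace S" "S \<subseteq> span B" "finite B"
    and E: "orthonormal g E" "E \<subseteq> S"
  shows "\<exists>F. E \<subseteq> F \<and> orthonormal g F \<and> span F = S"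
proof -
  obtain C where C: "C \<subseteq> S" "independent C" "S \<subseteq> span C"
    using maximal_independent_subset[of S] by blast
  have "finite C" using independent_span_bound[OF S(3) C(2)] C(1) S(2) by blast
  then obtain F where F: "E \<subseteq> F" "orthonormal g F" "span F = span (E \<union> C)"
    using orthonormal_extend[OF g E(1)] by blast
  have "span (E \<union> C) = S"
    using C E(2) S(1) by (meson Un_least Un_upper2 span_minimal span_mono subset_antisym subset_trans)
  then show ?thesis using F by auto
qed

text \<open>Expand the first argument of \<open>h e e\<close> in the other basis, exchange the sums, and collect.\<close>

lemma contraction_basis_independent:
  assumes g: "inner_product g" and E: "orthonormal g E" and F: "orthonormal g F"
    and span: "span E = span F" and h: "bilinear (h :: 'a::real_vector \<Rightarrow> 'a \<Rightarrow> real)"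
  shows "(\<Sum>e\<in>E. h e e) = (\<Sum>f\<in>F. h f f)"
proof -
  note gb = inner_product_bilinear[OF g]
  have eF: "h e e = (\<Sum>f\<in>F. g e f * h f e)" if "e \<in> E" for e
    using orthonormal_expansion_linear[OF gb F _ linear_form_left[OF h], of e e] span
      span_base[OF that] by simp
  have fE: "h f f = (\<Sum>e\<in>E. g f e * h f e)" if "f \<in> F" for f
    using orthonormal_expansion_linear[OF gb E _ linear_form_right[OF h], of f f] span
      span_base[OF that] by simp
  have "(\<Sum>e\<in>E. h e e) = (\<Sum>e\<in>E. \<Sum>f\<in>F. g e f * h f e)"
    by (intro sum.cong refl eF)
  also have "\<dots> = (\<Sum>f\<in>F. \<Sum>e\<in>E. g f e * h f e)"
    unfolding sum.swap[of "\<lambda>e f. g e f * h f e" F E] by (intro sum.cong refl) (metis inner_product_sym[OF g])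
  also have "\<dots> = (\<Sum>f\<in>F. h f f)"
    by (intro sum.cong refl fE[symmetric])
  finally show ?thesis .
qed

lemma contraction_isometry_invariant:
  assumes g: "inner_product g" and E: "orthonormal g E"
    and J: "linear J" "J ` span E = span E" "\<And>x y. g (J x) (J y) = g x y"
    and h: "bilinear (h :: 'a::real_vector \<Rightarrow> 'a \<Rightarrow> real)"
  shows "(\<Sum>e\<in>E. h (J e) (J e)) = (\<Sum>e\<in>E. h e e)"
proof -
  have inj: "inj_on J E"
  proof (rule inj_onI)
    fix x y assume "J x = J y"
    then have "g (J (x - y)) (J (x - y)) = 0"
      by (simp add: linear_diff[OF J(1)] bilinear_lzero[OF inner_product_bilinear[OF g]])
    then show "x = y" using inner_product_eq_0[OF g, of "x - y"] by (simp add: J(3))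
  qed
  have "orthonormal g (J ` E)"
    using E inj by (auto simp: orthonormal_def J(3) inj_on_def)
  then have "(\<Sum>f\<in>J ` E. h f f) = (\<Sum>e\<in>E. h e e)"
    by (rule contraction_basis_independent[OF g _ E _ h]) (simp add: linear_span_image[OF J(1)] J(2))
  then show ?thesis by (simp add: sum.reindex[OF inj])
qed

text \<open>An orthonormal basis adapted to the flag of kernels \<open>ker T \<subseteq> ker T^2 \<subseteq> \<dots>\<close> makes the
  matrix of a nilpotent \<open>T\<close> strictly triangular.\<close>

lemma trace_nilpotent:
  assumes g: "inner_product g" and E: "orthonormal g E"
    and T: "linear T" "\<And>x. x \<in> span E \<Longrightarrow> T x \<in> span E"
    and nil: "\<And>x. x \<in> span E \<Longrightarrow> (T ^^ k) x = 0"
  shows "(\<Sum>e\<in>E. g (T e) e) = 0"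
proof -
  note gb = inner_product_bilinear[OF g]
  have finE: "finite E" using E by (simp add: orthonormal_def)
  have lin: "linear (T ^^ j)" for j
    by (induction j) (simp_all only: funpow.simps linear_id linear_compose[OF _ T(1)])
  define U where "U j = {x \<in> span E. (T ^^ j) x = 0}" for j
  have sub: "subspace (U j)" for j
    unfolding U_def subspace_def
    by (auto simp: linear_add[OF lin] linear_scale[OF lin] linear_0[OF lin] span_add span_scale span_zero)
  have "\<exists>F. orthonormal g F \<and> span F = U j \<and> (\<forall>f\<in>F. g (T f) f = 0)" for j
  proof (induction j)
    case 0
    have "U 0 = {0}" by (auto simp: U_def span_zero)
    then show ?case by (intro exI[of _ "{}"]) (auto simp: orthonormal_def)
  next
    case (Suc j)
    then obtain F where F: "orthonormal g F" "span F = U j" "\<forall>f\<in>F. g (T f) f = 0" by blast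
    have "U j \<subseteq> U (Suc j)" by (auto simp: U_def linear_0[OF T(1)])
    then have "F \<subseteq> U (Suc j)" using F(2) span_superset by blast
    then obtain F' where F': "F \<subseteq> F'" "orthonormal g F'" "span F' = U (Suc j)"
      using orthonormal_basis_subspace[OF g sub _ finE F(1)] by (metis (no_types, lifting) U_def mem_Collect_eq subsetI)
    have "g (T f) f = 0" if f: "f \<in> F'" for f
    proof (cases "f \<in> F")
      case True
      then show ?thesis using F(3) by blast
    next
      case False
      have "f \<in> U (Suc j)" using f F'(3) span_base by blast
      then have "T f \<in> span F"
        using T(2) by (simp add: F(2) U_def funpow_Suc_right del: funpow.simps)
      then have "g (T f) f = (\<Sum>e\<in>F. g (T f) e * g f e)" by (rule parseval[OF g F(1)])
      also have "\<dots> = 0"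
      proof (intro sum.neutral ballI)
        fix e assume "e \<in> F"
        then have "e \<in> F'" "e \<noteq> f" using F'(1) False by auto
        then show "g (T f) e * g f e = 0" using F'(2) f by (auto simp: orthonormal_def)
      qed
      finally show ?thesis .
    qed
    then show ?case using F' by blast
  qed
  then obtain F where F: "orthonormal g F" "span F = U k" "\<forall>f\<in>F. g (T f) f = 0" by blast
  have "span F = span E" using nil F(2) by (auto simp: U_def)
  moreover have "bilinear (\<lambda>x y. g (T x) y)"
    using gb T(1) linear_compose[OF T(1)] by (auto simp: bilinear_def o_def)
  ultimately have "(\<Sum>e\<in>E. g (T e) e) = (\<Sum>f\<in>F. g (T f) f)"
    using contraction_basis_independent[OF g E F(1)] by metis
  then show ?thesis using F(3) by simp
qed

text \<open>The sum is \<open>- tr (A S)\<close>, and taking transposes gives \<open>tr (A S) = - tr (S A) = - tr (A S)\<close>.\<close>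

lemma trace_skew_symmetric:
  assumes g: "inner_product g" and E: "orthonormal g E"
    and A: "\<And>x. x \<in> span E \<Longrightarrow> A x \<in> span E" "\<And>x y. x \<in> span E \<Longrightarrow> y \<in> span E \<Longrightarrow> g (A x) y = - g x (A y)"
    and S: "\<And>x. x \<in> span E \<Longrightarrow> S x \<in> span E" "\<And>x y. x \<in> span E \<Longrightarrow> y \<in> span E \<Longrightarrow> g (S x) y = g x (S y)"
  shows "(\<Sum>e\<in>E. g (A e) (S e)) = 0"
proof -
  note E_span = span_base[of _ E]
  have "(\<Sum>e\<in>E. g (A e) (S e)) = (\<Sum>e\<in>E. \<Sum>f\<in>E. g (A e) f * g (S e) f)"
    by (intro sum.cong refl parseval[OF g E] A E_span)
  also have "\<dots> = - (\<Sum>e\<in>E. \<Sum>f\<in>E. g (A f) e * g (S f) e)"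
    unfolding sum_negf[symmetric]
  proof (intro sum.cong refl)
    fix e f assume "e \<in> E" "f \<in> E"
    then have "g (A e) f = - g (A f) e" "g (S e) f = g (S f) e"
      using A(2) S(2) by (metis E_span inner_product_sym[OF g])+
    then show "g (A e) f * g (S e) f = - (g (A f) e * g (S f) e)" by simp
  qed
  also have "(\<Sum>e\<in>E. \<Sum>f\<in>E. g (A f) e * g (S f) e) = (\<Sum>f\<in>E. \<Sum>e\<in>E. g (A f) e * g (S f) e)"
    by (rule sum.swap)
  also have "\<dots> = (\<Sum>e\<in>E. g (A e) (S e))"
    by (intro sum.cong refl parseval[OF g E, symmetric] A E_span)
  finally show ?thesis by simp
qed

lemma orthonormal_mono: "orthonormal g E \<Longrightarrow> F \<subseteq> E \<Longrightarrow> orthonormal g F"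
  unfolding orthonormal_def by (meson finite_subset subsetD)

lemma orthonormal_independent:
  assumes g: "inner_product g" and E: "orthonormal g E"
  shows "independent E"
proof
  assume "dependent E"
  then obtain e where e: "e \<in> E" "e \<in> span (E - {e})" by (auto simp: dependent_def)
  have "g e e = (\<Sum>f\<in>E - {e}. g e f * g e f)"
    by (rule parseval[OF g orthonormal_mono[OF E] e(2)]) auto
  also have "\<dots> = 0"
    using E e(1) by (intro sum.neutral) (auto simp: orthonormal_def)
  finally show False using E e(1) by (auto simp: orthonormal_def)
qed

lemma dim_orthonormal: "inner_product g \<Longrightarrow> orthonormal g E \<Longrightarrow> dim (span E) = card E"
  using dim_span_eq_card_independent orthonormal_independent by blast

text \<open>Both sides are the same double sum of matrix entries.\<close>

lemma trace_commute:
  assumes g: "inner_product g" and E: "orthonormal g E"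
    and X: "linear X" "X ` span E \<subseteq> span E" and Y: "linear Y" "Y ` span E \<subseteq> span E"
  shows "(\<Sum>e\<in>E. g (X (Y e)) e) = (\<Sum>e\<in>E. g (Y (X e)) e)"
proof -
  note gb = inner_product_bilinear[OF g]
  have expand: "g (X (Y e)) e = (\<Sum>f\<in>E. g (Y e) f * g (X f) e)"
    if "linear X" "Y ` span E \<subseteq> span E" "e \<in> E" for X Y e
  proof -
    have "Y e \<in> span E" using that span_base by blast
    from orthonormal_expansion_linear[OF gb E this, of "\<lambda>x. g (X x) e"]
    show ?thesis using linear_compose[OF that(1) linear_form_left[OF gb, of e]] by (simp add: o_def)
  qed
  have "(\<Sum>e\<in>E. g (X (Y e)) e) = (\<Sum>e\<in>E. \<Sum>f\<in>E. g (Y e) f * g (X f) e)"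
    by (intro sum.cong refl expand X Y)
  also have "\<dots> = (\<Sum>f\<in>E. \<Sum>e\<in>E. g (X f) e * g (Y e) f)"
    by (subst sum.swap) (simp only: mult.commute)
  also have "\<dots> = (\<Sum>f\<in>E. g (Y (X f)) f)"
    by (intro sum.cong refl expand[symmetric] X Y)
  finally show ?thesis .
qed

text \<open>A nonzero kernel vector extends to a basis; the images of the other basis vectors would span the
  whole space with one vector too few.\<close>

lemma surjective_imp_injective_on_span:
  assumes E: "finite E" and W: "linear W" "W ` span E = span E" and x: "x \<in> span E" "W x = 0"
  shows "x = 0"
proof (rule ccontr)
  assume "x \<noteq> 0"
  then have "independent {x}" by simp
  then obtain C where C: "{x} \<subseteq> C" "C \<subseteq> span E" "independent C" "span E \<subseteq> span C"
    using maximal_independent_subset_extend[of "{x}" "span E"] x(1) by auto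
  have fin: "finite C" using independent_span_bound[OF E C(3,2)] by simp
  have C_span: "span C = span E" using C(2,4) span_minimal subspace_span by blast
  have "W ` C \<subseteq> span (W ` (C - {x}))"
  proof
    fix w assume "w \<in> W ` C"
    then obtain y where y: "w = W y" "y \<in> C" by blast
    then show "w \<in> span (W ` (C - {x}))"
      using x(2) by (cases "y = x") (auto intro: span_base span_zero)
  qed
  then have "span (W ` C) \<subseteq> span (W ` (C - {x}))" by (simp add: span_minimal)
  moreover have "span (W ` C) = span E" using linear_span_image[OF W(1), of C] W(2) C_span by simp
  ultimately have "C \<subseteq> span (W ` (C - {x}))" using C(2) by blast
  from independent_span_bound[OF _ C(3) this]
  have "card C \<le> card (W ` (C - {x}))" using fin by simp
  also have "\<dots> \<le> card (C - {x})" using fin by (intro card_image_le) simp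
  also have "\<dots> < card C" using fin C(1) by (intro psubset_card_mono) auto
  finally show False by simp
qed

text \<open>If \<open>W\<close> is not surjective, its range is a smaller space invariant under \<open>U\<close> and \<open>W\<close>.  If \<open>W\<close> is
  surjective, it is invertible, and \<open>U - W U W\<^sup>-\<^sup>1 = l\<close> has trace zero, so the space is zero.\<close>

lemma commutator_multiple_imp_nilpotent:
  assumes g: "inner_product g" and E: "orthonormal g E"
    and U: "linear U" "U ` span E \<subseteq> span E" and W: "linear W" "W ` span E \<subseteq> span E"
    and comm: "\<And>x. x \<in> span E \<Longrightarrow> U (W x) - W (U x) = l *\<^sub>R W x" and l: "l \<noteq> 0"
  shows "\<exists>k. \<forall>x\<in>span E. (W ^^ k) x = 0"
  using E U(2) W(2) comm
proof (induction "card E" arbitrary: E rule: less_induct)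
  case (less E)
  note gb = inner_product_bilinear[OF g]
  have finE: "finite E" using less.prems(1) by (simp add: orthonormal_def)
  show ?case
  proof (cases "W ` span E = span E")
    case True
    obtain C where C: "range C \<subseteq> span E" "linear C" "\<forall>v\<in>W ` span E. W (C v) = v"
      using linear_exists_right_inverse_on[OF W(1) subspace_span, of E] by auto
    have WC: "W (C x) = x" if "x \<in> span E" for x using C(3) True that by simp
    have CW: "C (W x) = x" if "x \<in> span E" for x
    proof -
      have "W x \<in> span E" using that True by blast
      then have "W (C (W x) - x) = 0" using WC by (simp add: linear_diff[OF W(1)])
      moreover have "C (W x) - x \<in> span E" using C(1) that by (intro span_diff) auto
      ultimately show ?thesis using surjective_imp_injective_on_span[OF finE W(1) True] by force
    qed
    have "(\<Sum>e\<in>E. g (U e) e) = (\<Sum>e\<in>E. g (U (W (C e))) e)"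
      by (intro sum.cong refl) (simp add: WC span_base)
    also have "\<dots> = (\<Sum>e\<in>E. g (W (U (C e))) e + l * g e e)"
    proof (intro sum.cong refl)
      fix e assume "e \<in> E"
      have "C e \<in> span E" using C(1) by auto
      from less.prems(4)[OF this] have "U (W (C e)) = W (U (C e)) + l *\<^sub>R e"
        using WC[OF span_base[OF \<open>e \<in> E\<close>]] by (simp add: algebra_simps)
      then show "g (U (W (C e))) e = g (W (U (C e))) e + l * g e e"
        by (simp add: bilinear_ladd[OF gb] bilinear_lmul[OF gb])
    qed
    also have "\<dots> = (\<Sum>e\<in>E. g (U (C (W e))) e) + l * real (card E)"
    proof -
      have "(U \<circ> C) ` span E \<subseteq> span E" using less.prems(2) C(1) by auto
      from trace_commute[OF g less.prems(1) W(1) less.prems(3) linear_compose[OF C(2) U(1)] this]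
      have "(\<Sum>e\<in>E. g (W (U (C e))) e) = (\<Sum>e\<in>E. g (U (C (W e))) e)" by simp
      moreover have "(\<Sum>e\<in>E. l * g e e) = (\<Sum>e\<in>E. l)"
        using less.prems(1) by (intro sum.cong) (auto simp: orthonormal_def)
      ultimately show ?thesis by (simp add: sum.distrib)
    qed
    also have "(\<Sum>e\<in>E. g (U (C (W e))) e) = (\<Sum>e\<in>E. g (U e) e)"
      by (intro sum.cong refl) (simp add: CW span_base)
    finally have "E = {}" using l finE by simp
    then show ?thesis by (intro exI[of _ 0]) simp
  next
    case False
    let ?S = "W ` span E"
    have "subspace ?S" using linear_subspace_image[OF W(1)] by simp
    then obtain F where F: "orthonormal g F" "span F = ?S"
      using orthonormal_basis_subspace[OF g _ less.prems(3) finE, of "{}"] by (auto simp: orthonormal_def)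
    have "card F < card E"
    proof (rule ccontr)
      assume "\<not> card F < card E"
      obtain F' where F': "F \<subseteq> F'" "orthonormal g F'" "span F' = span E"
        using orthonormal_basis_subspace[OF g subspace_span subset_refl finE F(1)] F(2) less.prems(3)
          span_superset by (metis subset_trans)
      have "card F' = card E" using dim_orthonormal[OF g] F'(2,3) less.prems(1) by metis
      moreover have "finite F'" using F'(2) by (simp add: orthonormal_def)
      ultimately have "F = F'" using \<open>\<not> card F < card E\<close> card_mono[OF _ F'(1)]
        by (intro card_subset_eq F'(1)) auto
      then show False using F(2) F'(3) False by simp
    qed
    moreover have "U ` span F \<subseteq> span F"
    proof -
      have "U (W x) \<in> ?S" if x: "x \<in> span E" for x
      proof -
        have "U (W x) = W (U x + l *\<^sub>R x)"
          using less.prems(4)[OF x] by (simp add: linear_add[OF W(1)] linear_scale[OF W(1)] algebra_simps)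
        then show ?thesis using less.prems(2) x by (auto intro!: imageI span_add span_scale)
      qed
      then show ?thesis by (auto simp: F(2))
    qed
    moreover have "W ` span F \<subseteq> span F" using less.prems(3) by (auto simp: F(2))
    moreover have "U (W x) - W (U x) = l *\<^sub>R W x" if "x \<in> span F" for x
      using that less.prems(3,4) F(2) by blast
    ultimately obtain k where "\<forall>x\<in>span F. (W ^^ k) x = 0"
      using less.hyps[OF _ F(1)] by blast
    then have "(W ^^ Suc k) x = 0" if "x \<in> span E" for x
      using that F(2) by (simp add: funpow_Suc_right del: funpow.simps)
    then show ?thesis by blast
  qed
qed

text \<open>This turns an identity between traces into the symmetry of an operator: the right hand side is minus
  half the squared norm of \<open>M - M\<^sup>T\<close>.\<close>

lemma trace_square_defect:
  assumes g: "inner_product g" and E: "orthonormal g E" and M: "linear M" "M ` span E \<subseteq> span E"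
  shows "(\<Sum>e\<in>E. g (M (M e)) e - g (M e) (M e))
    = - (1/2) * (\<Sum>e\<in>E. \<Sum>f\<in>E. (g (M e) f - g (M f) e)\<^sup>2)"
proof -
  note gb = inner_product_bilinear[OF g]
  let ?m = "\<lambda>e f. g (M e) f"
  have Me: "M e \<in> span E" if "e \<in> E" for e using M(2) that span_base by blast
  have 1: "g (M (M e)) e = (\<Sum>f\<in>E. ?m e f * ?m f e)" if "e \<in> E" for e
    using orthonormal_expansion_linear[OF gb E Me[OF that] linear_compose[OF M(1) linear_form_left[OF gb, of e]]]
    by (simp add: o_def)
  have 2: "g (M e) (M e) = (\<Sum>f\<in>E. (?m e f)\<^sup>2)" if "e \<in> E" for e
    using parseval[OF g E Me[OF that], of "M e"] by (simp add: power2_eq_square)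
  have "(\<Sum>e\<in>E. \<Sum>f\<in>E. (?m e f - ?m f e)\<^sup>2)
    = (\<Sum>e\<in>E. \<Sum>f\<in>E. (?m e f)\<^sup>2) + (\<Sum>e\<in>E. \<Sum>f\<in>E. (?m f e)\<^sup>2) - 2 * (\<Sum>e\<in>E. \<Sum>f\<in>E. ?m e f * ?m f e)"
    by (simp add: power2_diff sum.distrib sum_subtractf sum_distrib_left mult.assoc)
  also have "(\<Sum>e\<in>E. \<Sum>f\<in>E. (?m f e)\<^sup>2) = (\<Sum>e\<in>E. \<Sum>f\<in>E. (?m e f)\<^sup>2)" by (rule sum.swap)
  also have "(\<Sum>e\<in>E. \<Sum>f\<in>E. (?m e f)\<^sup>2) = (\<Sum>e\<in>E. g (M e) (M e))" by (simp add: 2)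
  also have "(\<Sum>e\<in>E. \<Sum>f\<in>E. ?m e f * ?m f e) = (\<Sum>e\<in>E. g (M (M e)) e)" by (simp add: 1)
  finally show ?thesis unfolding sum_subtractf by linarith
qed

section \<open>Generalized Kaehler pairs on nilpotent quadratic Lie algebras\<close>

lemma lie_bracket_skew:
  assumes "lie_bracket br"
  shows "br y x = - br x y"
proof -
  have br: "bilinear br" and self: "br x x = 0" for x
    using assms by (auto simp: lie_bracket_def)
  have "br (x + y) (x + y) = br x x + br y y + (br x y + br y x)"
    by (simp add: bilinear_ladd[OF br] bilinear_radd[OF br] algebra_simps)
  then have "br x y + br y x = 0" by (simp add: self)
  then show ?thesis by (metis add.inverse_unique)
qed

text \<open>The generalized-geometric form of a generalized Kaehler structure: the pairing \<open>b\<close> is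
  indefinite, \<open>J\<close> and \<open>K\<close> are generalized complex structures, and \<open>b (J x) (K x) = - b (J K x) x\<close> is
  the positive definite generalized metric.\<close>

locale quadratic_gk_pair =
  fixes br :: "'b::real_vector \<Rightarrow> 'b \<Rightarrow> 'b" and b :: "'b \<Rightarrow> 'b \<Rightarrow> real" and J K :: "'b \<Rightarrow> 'b"
  assumes lie: "lie_bracket br"
    and form: "bilinear b" and form_sym: "b x y = b y x"
    and invariant: "b (br x y) z = b x (br y z)"
    and J_int: "integrable_complex_structure br J"
    and K_int: "integrable_complex_structure br K"
    and JK: "J (K x) = K (J x)"
    and J_orth: "b (J x) (J y) = b x y"
    and K_orth: "b (K x) (K y) = b x y"
    and positive: "x \<noteq> 0 \<Longrightarrow> 0 < b (J x) (K x)"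
begin

lemma J_lin: "linear J" and J_sq: "J (J x) = - x"
  and J_curl: "br x y + J (br (J x) y + br x (J y)) - br (J x) (J y) = 0"
  using J_int by (auto simp: integrable_complex_structure_def)

lemma K_lin: "linear K" and K_sq: "K (K x) = - x"
  and K_curl: "br x y + K (br (K x) y + br x (K y)) - br (K x) (K y) = 0"
  using K_int by (auto simp: integrable_complex_structure_def)

lemma bracket: "bilinear br" and bracket_self: "br x x = 0"
  and jacobi: "br x (br y z) + br y (br z x) + br z (br x y) = 0"
  using lie by (auto simp: lie_bracket_def)

lemma bracket_skew: "br y x = - br x y"
  using lie by (rule lie_bracket_skew)

lemmas br_simps = bilinear_ladd[OF bracket] bilinear_radd[OF bracket] bilinear_lsub[OF bracket]
  bilinear_rsub[OF bracket] bilinear_lneg[OF bracket] bilinear_rneg[OF bracket]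
  bilinear_lmul[OF bracket] bilinear_rmul[OF bracket] bilinear_lzero[OF bracket] bilinear_rzero[OF bracket]

lemmas b_simps = bilinear_ladd[OF form] bilinear_radd[OF form] bilinear_lsub[OF form]
  bilinear_rsub[OF form] bilinear_lneg[OF form] bilinear_rneg[OF form]
  bilinear_lmul[OF form] bilinear_rmul[OF form] bilinear_lzero[OF form] bilinear_rzero[OF form]

lemmas J_simps = linear_add[OF J_lin] linear_diff[OF J_lin] linear_neg[OF J_lin] linear_scale[OF J_lin]
  linear_0[OF J_lin] J_sq
lemmas K_simps = linear_add[OF K_lin] linear_diff[OF K_lin] linear_neg[OF K_lin] linear_scale[OF K_lin]
  linear_0[OF K_lin] K_sq

lemma invariant_skew: "b (br x y) z = - b y (br x z)"
  using invariant[of y x z] by (simp add: bracket_skew[of x y] b_simps)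

lemma J_skew: "b (J x) y = - b x (J y)"
  using J_orth[of x "J y"] by (simp add: J_sq b_simps)

definition metric :: "'b \<Rightarrow> 'b \<Rightarrow> real" where "metric x y = b (J x) (K y)"

text \<open>The eigenspaces of \<open>- J K\<close>.  The pairing is positive definite on \<open>Vp\<close>, negative definite on \<open>Vm\<close>,
  and agrees up to this sign with the generalized metric.\<close>

definition Vp :: "'b set" where "Vp = {x. K x = J x}"
definition Vm :: "'b set" where "Vm = {x. K x = - J x}"

definition P :: "'b \<Rightarrow> 'b" where "P x = (1/2) *\<^sub>R (x - J (K x))"
definition Q :: "'b \<Rightarrow> 'b" where "Q x = (1/2) *\<^sub>R (x + J (K x))"

lemma P_lin: "linear P" and Q_lin: "linear Q"
  by (auto intro!: linearI simp: P_def Q_def J_simps K_simps algebra_simps)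

lemmas P_simps = linear_add[OF P_lin] linear_diff[OF P_lin] linear_neg[OF P_lin] linear_scale[OF P_lin] linear_0[OF P_lin]
lemmas Q_simps = linear_add[OF Q_lin] linear_diff[OF Q_lin] linear_neg[OF Q_lin] linear_scale[OF Q_lin] linear_0[OF Q_lin]

lemma P_in: "P x \<in> Vp"
proof -
  have "K (P x) = (1/2) *\<^sub>R (K x + J x)" "J (P x) = (1/2) *\<^sub>R (K x + J x)"
    unfolding P_def by (simp_all add: J_simps K_simps flip: JK)
  then show ?thesis by (simp add: Vp_def)
qed

lemma Q_in: "Q x \<in> Vm"
proof -
  have "K (Q x) = (1/2) *\<^sub>R (K x - J x)" "J (Q x) = (1/2) *\<^sub>R (J x - K x)"
    unfolding Q_def by (simp_all add: J_simps K_simps flip: JK)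
  then show ?thesis by (simp add: Vm_def flip: scaleR_minus_right)
qed

lemma decompose: "P x + Q x = x"
proof -
  have "P x + Q x = (1/2) *\<^sub>R (x + x)" by (simp add: P_def Q_def flip: scaleR_add_right)
  then show ?thesis by (simp flip: scaleR_2)
qed

lemma P_Vp: "x \<in> Vp \<Longrightarrow> P x = x" and Q_Vp: "x \<in> Vp \<Longrightarrow> Q x = 0"
  and P_Vm: "x \<in> Vm \<Longrightarrow> P x = 0" and Q_Vm: "x \<in> Vm \<Longrightarrow> Q x = x"
  by (simp_all add: P_def Q_def Vp_def Vm_def J_simps scaleR_2[symmetric])

lemma PJ: "P (J x) = J (P x)" and QJ: "Q (J x) = J (Q x)"
  by (simp_all add: P_def Q_def J_simps JK)

lemma QK: "Q (K x) = - J (Q x)"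
  by (simp add: Q_def J_simps K_simps flip: JK) (simp flip: scaleR_minus_right)

lemma J_Vp: "x \<in> Vp \<Longrightarrow> J x \<in> Vp" and J_Vm: "x \<in> Vm \<Longrightarrow> J x \<in> Vm"
  by (simp_all add: Vp_def Vm_def J_simps flip: JK)

lemma subspace_Vp: "subspace Vp"
  by (auto simp: subspace_def Vp_def J_simps K_simps)

lemma Vp_Vm_orth: "x \<in> Vp \<Longrightarrow> y \<in> Vm \<Longrightarrow> b x y = 0"
  using K_orth[of x y] by (simp add: Vp_def Vm_def b_simps J_orth)

lemma b_P: "y \<in> Vp \<Longrightarrow> b (P x) y = b x y" "y \<in> Vp \<Longrightarrow> b y (P x) = b y x"
  using decompose[of x] Vp_Vm_orth[of y "Q x"] Q_in form_sym
  by (metis add.right_neutral bilinear_radd[OF form])+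

lemma b_Q: "y \<in> Vm \<Longrightarrow> b (Q x) y = b x y" "y \<in> Vm \<Longrightarrow> b y (Q x) = b y x"
  using decompose[of x] Vp_Vm_orth[of "P x" y] P_in form_sym
  by (metis add_0 bilinear_radd[OF form])+

lemma b_split: "b x y = b (P x) (P y) + b (Q x) (Q y)"
proof -
  have "b x y = b x (P y) + b x (Q y)" using decompose[of y] by (metis bilinear_radd[OF form])
  then show ?thesis by (simp add: b_P(1)[OF P_in] b_Q(1)[OF Q_in])
qed

lemma metric_Vp: "x \<in> Vp \<Longrightarrow> metric x y = b x y" "y \<in> Vp \<Longrightarrow> metric x y = b x y"
proof -
  have "b (J x) (K y) = b (K (J x)) (K (K y))" by (simp add: K_orth)
  then show "x \<in> Vp \<Longrightarrow> metric x y = b x y"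
    by (simp add: metric_def Vp_def K_sq b_simps J_sq flip: JK)
  show "y \<in> Vp \<Longrightarrow> metric x y = b x y" by (simp add: metric_def Vp_def J_orth)
qed

lemma metric_Vm: "y \<in> Vm \<Longrightarrow> metric x y = - b x y"
  by (simp add: metric_def Vm_def J_orth b_simps)

lemma inner_product_metric: "inner_product metric"
proof -
  have "bilinear metric"
    by (auto simp: bilinear_def linear_iff metric_def J_simps K_simps b_simps)
  moreover have "metric x y = metric y x" for x y
    using J_orth[of "K y" "J x"] K_orth[of "J y" "K x"] form_sym JK
    by (metis J_sq K_sq b_simps(5,6) metric_def)
  ultimately show ?thesis using positive by (auto simp: inner_product_def metric_def)
qed

lemma b_neg_Vm: "x \<in> Vm \<Longrightarrow> b x x = 0 \<Longrightarrow> x = 0" "x \<in> Vm \<Longrightarrow> b x x \<le> 0"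
  using inner_product_eq_0[OF inner_product_metric, of x] inner_product_nonneg[OF inner_product_metric, of x]
  by (simp_all add: metric_Vm)

text \<open>Up to a factor, the bracket of the \<open>i\<close>-eigenspace of \<open>J\<close> in the complexification,
  transported to the real space: it is the real part of \<open>[u - i J u, v - i J v]\<close>.  By integrability it is
  complex bilinear for \<open>J\<close> (\<open>J_curly\<close>), which spares the complexification.\<close>

definition curly :: "'b \<Rightarrow> 'b \<Rightarrow> 'b" where "curly u v = br u v - br (J u) (J v)"

lemma curly_simps: "curly u (v + w) = curly u v + curly u w"
  by (simp add: curly_def J_simps br_simps)

lemma J_curly: "J (curly u v) = br (J u) v + br u (J v)"
proof -
  have "curly u v = - J (br (J u) v + br u (J v))"
    using J_curl[of u v] by (simp add: curly_def algebra_simps add_eq_0_iff)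
  then show ?thesis by (simp add: J_simps)
qed

lemma K_curly: "K (br u v - br (K u) (K v)) = br (K u) v + br u (K v)"
proof -
  have "br u v - br (K u) (K v) = - K (br (K u) v + br u (K v))"
    using K_curl[of u v] by (simp add: algebra_simps add_eq_0_iff)
  then show ?thesis by (simp add: K_simps)
qed

text \<open>On \<open>Vp\<close> the structures \<open>J\<close> and \<open>K\<close> coincide, so both integrability conditions speak of the same
  vector \<open>curly u v\<close> and give \<open>J\<close> and \<open>K\<close> the same value there; likewise, up to sign, on \<open>Vm\<close>.\<close>

lemma curly_Vp: assumes "u \<in> Vp" "v \<in> Vp" shows "curly u v \<in> Vp"
  using assms K_curly[of u v] J_curly[of u v] by (simp add: Vp_def curly_def)

lemma curly_Vm: assumes "u \<in> Vm" "v \<in> Vm" shows "curly u v \<in> Vm"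
  using assms K_curly[of u v] J_curly[of u v] by (simp add: Vm_def curly_def br_simps)

abbreviation lcs :: "nat \<Rightarrow> 'b set" where "lcs \<equiv> lower_central_series br UNIV"

lemma subspace_lcs: "subspace (lcs k)"
  by (cases k) (simp_all add: bracket_span_def)

lemma lcs_step: "y \<in> lcs k \<Longrightarrow> br x y \<in> lcs (Suc k)"
  by (auto simp: bracket_span_def intro!: span_base)

text \<open>Nilpotency passes to \<open>curly\<close> once membership is tracked for \<open>w\<close> and \<open>J w\<close> together.\<close>

lemma curly_lcs:
  assumes "w \<in> lcs k" "J w \<in> lcs k"
  shows "curly u w \<in> lcs (Suc k)" "J (curly u w) \<in> lcs (Suc k)"
  unfolding J_curly unfolding curly_def
  using assms by (auto intro!: subspace_diff[OF subspace_lcs] subspace_add[OF subspace_lcs] lcs_step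
    simp del: lower_central_series.simps)

text \<open>\<open>u \<mapsto> (v \<mapsto> Q [u, v])\<close> is a Bismut connection \<open>\<nabla>\<close>, which preserves its complex structure.  The two
  integrability conditions differ only in signs here, and their sum is the claim.\<close>

lemma parallel_Vm:
  assumes u: "u \<in> Vp" and v: "v \<in> Vm"
  shows "Q (br u (J v)) = J (Q (br u v))"
proof -
  have 1: "J (Q (br u v) - Q (br (J u) (J v))) = Q (br (J u) v) + Q (br u (J v))"
    using arg_cong[OF J_curly[of u v], of Q] by (simp add: QJ curly_def Q_simps)
  have "K (br u v + br (J u) (J v)) = br (J u) v - br u (J v)"
    using K_curly[of u v] u v by (simp add: Vp_def Vm_def br_simps)
  from arg_cong[OF this, of Q]
  have 2: "- J (Q (br u v) + Q (br (J u) (J v))) = Q (br (J u) v) - Q (br u (J v))"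
    by (simp add: QK Q_simps)
  have "2 *\<^sub>R J (Q (br u v)) = 2 *\<^sub>R Q (br u (J v))"
    using arg_cong2[OF 1 2, of "(-)"] by (simp add: J_simps scaleR_2)
  then show ?thesis by simp
qed

end

text \<open>Reversing \<open>b\<close> and \<open>K\<close> exchanges \<open>Vp\<close> and \<open>Vm\<close>, so that each statement is needed only once.\<close>

lemma (in quadratic_gk_pair) swap: "quadratic_gk_pair br (\<lambda>x y. - b x y) J (\<lambda>x. - K x)"
proof
  show "bilinear (\<lambda>x y. - b x y)"
    by (auto simp: bilinear_def linear_iff b_simps)
  show "integrable_complex_structure br (\<lambda>x. - K x)"
    unfolding integrable_complex_structure_def
  proof (intro conjI allI)
    show "br x y + - K (br (- K x) y + br x (- K y)) - br (- K x) (- K y) = 0" for x y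
      using K_curl[of x y] by (simp add: br_simps K_simps add.commute)
  qed (simp_all add: K_lin K_sq K_simps linear_compose_neg)
qed (use lie form_sym invariant J_int JK J_orth K_orth positive in \<open>auto simp: J_simps b_simps\<close>)

context quadratic_gk_pair
begin

lemma swap_eqs:
  "quadratic_gk_pair.Vp J (\<lambda>x. - K x) = Vm" "quadratic_gk_pair.Vm J (\<lambda>x. - K x) = Vp"
  "quadratic_gk_pair.P J (\<lambda>x. - K x) = Q" "quadratic_gk_pair.Q J (\<lambda>x. - K x) = P"
proof -
  interpret s: quadratic_gk_pair br "\<lambda>x y. - b x y" J "\<lambda>x. - K x" by (rule swap)
  show "s.Vp = Vm" "s.Vm = Vp" "s.P = Q" "s.Q = P"
    by (auto simp: s.Vp_def s.Vm_def Vp_def Vm_def s.P_def s.Q_def P_def Q_def J_simps minus_equation_iff fun_eq_iff)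
qed

lemma parallel_Vp:
  assumes "u \<in> Vp" and "v \<in> Vm"
  shows "P (br v (J u)) = J (P (br v u))"
  using quadratic_gk_pair.parallel_Vm[OF swap, of v u] assms by (simp add: swap_eqs)

text \<open>The sum is, up to sign, the trace on \<open>Vp\<close> of \<open>J\<close> composed with the operator that \<open>curly u\<close>
  induces there: on the invariant subspace \<open>Vp\<close> if \<open>u \<in> Vp\<close>, on the quotient by the invariant subspace
  \<open>Vm\<close> if \<open>u \<in> Vm\<close>.  Both are nilpotent.\<close>

lemma trace_zero:
  assumes nil: "lcs N = {0}" and E: "orthonormal metric E" "span E = Vp"
    and u: "u \<in> Vp \<or> u \<in> Vm"
  shows "(\<Sum>e\<in>E. b u (br e (J e))) = 0"
proof -
  define T where "T x = J (P (curly u x))" for x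
  have T_lin: "linear T"
    by (auto intro!: linearI simp: T_def curly_def J_simps P_simps br_simps algebra_simps)
  have "\<exists>w. w \<in> lcs k \<and> J w \<in> lcs k \<and> (T ^^ k) x = P w \<and> (u \<in> Vp \<longrightarrow> w \<in> Vp)" if x: "x \<in> Vp" for x k
  proof (induction k)
    case 0
    show ?case using x by (intro exI[of _ x]) (simp add: P_Vp)
  next
    case (Suc k)
    then obtain w where w: "w \<in> lcs k" "J w \<in> lcs k" "(T ^^ k) x = P w" "u \<in> Vp \<longrightarrow> w \<in> Vp" by blast
    let ?w = "J (curly u w)"
    have "P (curly u (P w)) = P (curly u w)"
    proof (cases "u \<in> Vp")
      case True
      then show ?thesis using w(4) by (simp add: P_Vp)
    next
      case False
      then have "P (curly u (Q w)) = 0" using u by (intro P_Vm curly_Vm Q_in) auto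
      then show ?thesis using curly_simps[of u "P w" "Q w"] decompose[of w] by (simp add: P_simps)
    qed
    then have "(T ^^ Suc k) x = P ?w" using w(3) by (simp add: T_def PJ)
    moreover have "?w \<in> lcs (Suc k)" "J ?w \<in> lcs (Suc k)"
      using curly_lcs[OF w(1,2), of u] by (simp_all add: J_sq subspace_neg[OF subspace_lcs] del: lower_central_series.simps)
    moreover have "u \<in> Vp \<longrightarrow> ?w \<in> Vp" using w(4) by (auto intro: J_Vp curly_Vp)
    ultimately show ?case by blast
  qed
  then have "(T ^^ N) x = 0" if "x \<in> Vp" for x
    using that nil by (metis P_simps(5) singletonD)
  then have tr: "(\<Sum>e\<in>E. metric (T e) e) = 0"
    using trace_nilpotent[OF inner_product_metric E(1) T_lin, of N] E(2) by (simp add: T_def J_Vp P_in)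
  have "metric (T e) e = - b u (br e (J e))" if "e \<in> E" for e
  proof -
    have e: "e \<in> Vp" using that E(2) span_base by blast
    have "metric (T e) e = b (J (curly u e)) e"
      unfolding T_def using metric_Vp(2)[OF e] b_P(1)[OF e, of "J (curly u e)"] by (simp add: PJ)
    also have "\<dots> = b (J u) (br e e) + b u (br (J e) e)"
      by (simp add: J_curly b_simps invariant)
    finally show ?thesis by (simp add: bracket_self b_simps bracket_skew[of e "J e"])
  qed
  then show ?thesis using tr by (simp add: sum_negf)
qed

lemma trace_zero_all:
  assumes nil: "lcs N = {0}" and E: "orthonormal metric E" "span E = Vp"
  shows "(\<Sum>e\<in>E. b (br e (J e)) u) = 0"
proof -
  have "b (br e (J e)) u = b (P u) (br e (J e)) + b (Q u) (br e (J e))" for e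
    using decompose[of u] form_sym by (metis bilinear_ladd[OF form])
  then show ?thesis
    using trace_zero[OF assms, of "P u"] trace_zero[OF assms, of "Q u"] P_in Q_in
    by (simp add: sum.distrib)
qed

text \<open>By invariance each term is a double bracket paired with \<open>w\<close>, so the sum is a Jacobi identity.\<close>

lemma jacobi_pairing:
  "b (br x y) (br z w) + b (br y z) (br x w) + b (br z x) (br y w) = 0"
proof -
  have "b (br x y) (br z w) = b (br (br x y) z) w" for x y z w by (simp add: invariant)
  moreover have "br (br x y) z + br (br y z) x + br (br z x) y = 0"
    using jacobi[of x y z] by (simp add: bracket_skew[of _ "br _ _"] algebra_simps add_eq_0_iff)
  ultimately show ?thesis by (metis bilinear_ladd[OF form] bilinear_lzero[OF form])
qed

text \<open>With \<open>D\<^sub>u = \<nabla>\<^sub>u - J \<nabla>\<^sub>J\<^sub>u\<close> and its adjoint \<open>- \<nabla>\<^sub>u - J \<nabla>\<^sub>J\<^sub>u\<close>, four times the sum is, up to sign,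
  \<open>\<Sum> |D\<^sub>e\<^sup>* v|\<^sup>2 - |D\<^sub>e v|\<^sup>2\<close>.  It arises from \<open>jacobi_pairing\<close> at \<open>e, J e, v, J v\<close>: the first term sums to zero by
  \<open>trace_zero_all\<close>, and the \<open>Vp\<close>-parts of the other two sum to the trace of a skew operator times a symmetric one.\<close>

lemma mixed_square_sum:
  assumes nil: "lcs N = {0}" and E: "orthonormal metric E" "span E = Vp" and v: "v \<in> Vm"
  shows "(\<Sum>e\<in>E. b (Q (br e v)) (J (Q (br (J e) v)))) = 0"
proof -
  have Jv: "J v \<in> Vm" using v by (rule J_Vm)
  have E_Vp: "e \<in> Vp" if "e \<in> E" for e using that E(2) span_base by blast
  have pt: "b (br e (J e)) (br v (J v)) - 2 * b (Q (br e v)) (J (Q (br (J e) v)))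
      - 2 * b (P (br v e)) (J (P (br (J v) e))) = 0" if "e \<in> E" for e
  proof -
    note e = E_Vp[OF that]
    note Je = J_Vp[OF e]
    have 1: "Q (br e (J v)) = J (Q (br e v))" "Q (br (J e) (J v)) = J (Q (br (J e) v))"
      using parallel_Vm e Je v by auto
    have 2: "P (br (J e) v) = - J (P (br v e))" "P (br e (J v)) = - P (br (J v) e)"
        "P (br (J e) (J v)) = - J (P (br (J v) e))"
      using parallel_Vp[OF e v] parallel_Vp[OF e Jv]
      by (simp_all add: bracket_skew[of "J e" v] bracket_skew[of e "J v"] bracket_skew[of "J e" "J v"] P_simps)
    have "b (br (J e) v) (br e (J v)) = b (Q (br (J e) v)) (J (Q (br e v))) + b (J (P (br v e))) (P (br (J v) e))"
      unfolding b_split[of "br (J e) v"] by (simp add: 1 2 b_simps)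
    moreover have "b (br v e) (br (J e) (J v)) = - b (P (br v e)) (J (P (br (J v) e))) - b (Q (br e v)) (J (Q (br (J e) v)))"
      unfolding b_split[of "br v e"] by (simp add: 1 2 b_simps bracket_skew[of e v] Q_simps)
    moreover have "b (Q (br (J e) v)) (J (Q (br e v))) = - b (Q (br e v)) (J (Q (br (J e) v)))"
      by (metis J_skew form_sym)
    ultimately show ?thesis
      using jacobi_pairing[of e "J e" v "J v"] by (simp add: J_skew)
  qed
  have "(\<Sum>e\<in>E. metric (P (br v e)) (J (P (br (J v) e)))) = 0"
  proof (rule trace_skew_symmetric[OF inner_product_metric E(1), unfolded E(2)])
    show "metric (P (br v x)) y = - metric x (P (br v y))" if "x \<in> Vp" "y \<in> Vp" for x y
      using that by (simp add: metric_Vp b_P invariant_skew)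
    show "metric (J (P (br (J v) x))) y = metric x (J (P (br (J v) y)))" if "x \<in> Vp" "y \<in> Vp" for x y
    proof -
      have "metric (J (P (br (J v) x))) y = - b (P (br (J v) x)) (J y)"
        using metric_Vp(2)[OF that(2)] by (simp add: J_skew)
      also have "\<dots> = b x (br (J v) (J y))"
        unfolding b_P(1)[OF J_Vp[OF that(2)]] invariant_skew by simp
      also have "\<dots> = b x (J (P (br (J v) y)))"
        unfolding b_P(2)[OF that(1), of "br (J v) (J y)", symmetric] parallel_Vp[OF that(2) Jv] ..
      also have "\<dots> = metric x (J (P (br (J v) y)))"
        by (simp only: metric_Vp(1)[OF that(1)])
      finally show ?thesis .
    qed
  qed (simp_all add: P_in J_Vp)
  then have "(\<Sum>e\<in>E. b (P (br v e)) (J (P (br (J v) e)))) = 0"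
    by (simp add: metric_Vp P_in)
  moreover have "(\<Sum>e\<in>E. b (br e (J e)) (br v (J v)) - 2 * b (Q (br e v)) (J (Q (br (J e) v)))
      - 2 * b (P (br v e)) (J (P (br (J v) e)))) = 0"
    using pt by simp
  ultimately show ?thesis
    using trace_zero_all[OF nil E, of "br v (J v)"] by (simp add: sum_subtractf sum_distrib_left[symmetric])
qed

text \<open>The hypothesis \<open>D\<close> says \<open>\<nabla>\<^sub>u v = J \<nabla>\<^sub>J\<^sub>u v\<close>, which turns every term of \<open>mixed_square_sum\<close> into a value
  \<open>b x x\<close> of the form, which is negative definite on \<open>Vm\<close>.\<close>

lemma Vm_killed:
  assumes nil: "lcs N = {0}" and E: "orthonormal metric E" "span E = Vp" and v: "v \<in> Vm"
    and D: "\<And>u. u \<in> Vp \<Longrightarrow> Q (curly u v) = 0" and u: "u \<in> Vp"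
  shows "Q (br u v) = 0"
proof -
  have eq: "Q (br u v) = J (Q (br (J u) v))" if "u \<in> Vp" for u
    using D[OF that] parallel_Vm[OF J_Vp[OF that] v] by (simp add: curly_def Q_simps)
  have nonpos: "b (Q (br e v)) (Q (br e v)) \<le> 0" for e
    using b_neg_Vm(2)[OF Q_in] .
  have E_Vp: "e \<in> Vp" if "e \<in> E" for e using that E(2) span_base by blast
  have "(\<Sum>e\<in>E. b (Q (br e v)) (Q (br e v))) = (\<Sum>e\<in>E. b (Q (br e v)) (J (Q (br (J e) v))))"
    by (intro sum.cong refl) (metis eq E_Vp)
  also have "\<dots> = 0" by (rule mixed_square_sum[OF nil E v])
  finally have "\<forall>e\<in>E. - b (Q (br e v)) (Q (br e v)) = 0"
    using E(1) nonpos by (subst sum_nonneg_eq_0_iff[symmetric]) (auto simp: orthonormal_def sum_negf)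
  then have "Q (br e v) = 0" if "e \<in> E" for e using that b_neg_Vm(1)[OF Q_in] by force
  moreover have "linear (\<lambda>u. Q (br u v))"
    by (auto intro!: linearI simp: br_simps Q_simps)
  ultimately show ?thesis
    using u E(2) linear_eq_0_on_span[of "\<lambda>u. Q (br u v)" E u] by auto
qed

text \<open>Downward induction along the images \<open>R\<^sub>k\<close> in \<open>Vm\<close> of those vectors that lie in the \<open>k\<close>-th term of the
  lower central series together with their \<open>J\<close>-images.  The operators \<open>D\<^sub>u\<close> map \<open>R\<^sub>k\<close> to \<open>R\<^sub>k\<^sub>+\<^sub>1\<close>.  If
  \<open>\<nabla>\<close> vanishes on \<open>R\<^sub>k\<^sub>+\<^sub>1\<close>, so do the adjoints of the \<open>D\<^sub>u\<close>; a vector \<open>D\<^sub>u v\<close> in \<open>R\<^sub>k\<^sub>+\<^sub>1\<close> is then orthogonal to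
  itself, and \<open>Vm_killed\<close> applies to \<open>v\<close>.\<close>

lemma mixed_bracket_half:
  assumes nil: "lcs N = {0}" and fin: "finite B" "span B = (UNIV :: 'b set)"
    and u: "u \<in> Vp" and v: "v \<in> Vm"
  shows "Q (br u v) = 0"
proof -
  obtain E where E: "orthonormal metric E" "span E = Vp"
    using orthonormal_basis_subspace[OF inner_product_metric subspace_Vp _ fin(1), of "{}"] fin(2)
    by (auto simp: orthonormal_def)
  have step: "\<forall>u\<in>Vp. \<forall>w. w \<in> lcs (N - k) \<and> J w \<in> lcs (N - k) \<longrightarrow> Q (br u (Q w)) = 0" if "k \<le> N" for k
    using that
  proof (induction k)
    case 0
    then show ?case using nil by (auto simp: Q_simps br_simps)
  next
    case (Suc k)
    show ?case
    proof (intro ballI allI impI)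
      fix u w assume u: "u \<in> Vp" and w: "w \<in> lcs (N - Suc k) \<and> J w \<in> lcs (N - Suc k)"
      have "Q (curly u' (Q w)) = 0" if u': "u' \<in> Vp" for u'
      proof -
        let ?x = "Q (curly u' (Q w))"
        have "Q (curly u' (P w)) = 0" using u' by (intro Q_Vp curly_Vp P_in)
        then have x: "?x = Q (curly u' w)"
          using curly_simps[of u' "P w" "Q w"] decompose[of w] by (simp add: Q_simps)
        have "Suc (N - Suc k) = N - k" using Suc.prems by simp
        then have "curly u' w \<in> lcs (N - k)" "J (curly u' w) \<in> lcs (N - k)"
          using curly_lcs[of w "N - Suc k" u'] w by metis+
        then have par: "Q (br u'' ?x) = 0" if "u'' \<in> Vp" for u''
          using Suc x that by auto
        \<comment> \<open>Moving \<open>D\<close> to the other side of \<open>b ?x ?x\<close> leaves only values of \<open>\<nabla>\<close> at \<open>?x\<close>.\<close>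
        have "b ?x ?x = b (curly u' (Q w)) ?x" by (rule b_Q(1)[OF Q_in])
        also have "\<dots> = - b (Q w) (br u' ?x) + b (J (Q w)) (br (J u') ?x)"
          by (simp add: curly_def b_simps invariant_skew)
        also have "\<dots> = - b (Q w) (Q (br u' ?x)) + b (J (Q w)) (Q (br (J u') ?x))"
          by (simp add: b_Q Q_in J_Vm)
        also have "\<dots> = 0" using par u' by (simp add: J_Vp b_simps)
        finally show ?thesis by (rule b_neg_Vm(1)[OF Q_in])
      qed
      then show "Q (br u (Q w)) = 0" by (rule Vm_killed[OF nil E Q_in _ u])
    qed
  qed
  show ?thesis using step[of N] u Q_Vm[OF v] by (metis UNIV_I diff_self_eq_0 le_refl lower_central_series.simps(1))
qed

lemma mixed_bracket:
  assumes nil: "lcs N = {0}" and fin: "finite B" "span B = (UNIV :: 'b set)"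
    and u: "u \<in> Vp" and v: "v \<in> Vm"
  shows "br u v = 0"
proof -
  have "Q (br u v) = 0" by (rule mixed_bracket_half[OF assms])
  moreover have "P (br v u) = 0"
    using quadratic_gk_pair.mixed_bracket_half[OF swap nil fin, of v u] u v by (simp add: swap_eqs)
  ultimately show ?thesis using decompose[of "br u v"] by (simp add: bracket_skew[of u v] P_simps)
qed

text \<open>Since \<open>Vp\<close> and \<open>Vm\<close> are commuting ideals, \<open>ad x\<close> is skew for the positive definite metric as well, so
  \<open>(ad x)\<^sup>2 y = 0\<close> implies \<open>ad x y = 0\<close> (\<open>vanish\<close>); this pushes the last nonzero term of the lower central series
  down to the whole algebra.\<close>

theorem nilpotent_imp_abelian:
  assumes nil: "lcs N = {0}" and fin: "finite B" "span B = (UNIV :: 'b set)"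
  shows "br x y = 0"
proof -
  note mixed = mixed_bracket[OF nil fin]
  have same: "br u w \<in> Vp" if "u \<in> Vp" "w \<in> Vp" for u w
  proof -
    have "b (br u w) (Q (br u w)) = 0" using mixed[OF that(2) Q_in] by (simp add: invariant b_simps)
    then have "Q (br u w) = 0"
      using b_neg_Vm(1)[OF Q_in, of "br u w"] b_Q(1)[OF Q_in, of "br u w" "br u w"] by simp
    then show ?thesis using decompose[of "br u w"] P_in[of "br u w"] by simp
  qed
  have same': "br u w \<in> Vm" if "u \<in> Vm" "w \<in> Vm" for u w
  proof -
    have "b (br u w) (P (br u w)) = 0" using mixed[OF P_in that(2)] bracket_skew[of w "P (br u w)"]
      by (simp add: invariant b_simps)
    then have "metric (P (br u w)) (P (br u w)) = 0"
      using b_P(1)[OF P_in, of "br u w" "br u w"] by (simp add: metric_Vp P_in)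
    then have "P (br u w) = 0" by (simp add: inner_product_eq_0[OF inner_product_metric])
    then show ?thesis using decompose[of "br u w"] Q_in[of "br u w"] by simp
  qed
  have split: "br w x = br (P w) (P x) + br (Q w) (Q x)" for w x
  proof -
    have "br w x = br (P w + Q w) (P x + Q x)" using decompose by metis
    then show ?thesis using mixed[OF P_in Q_in] bracket_skew[of "Q w" "P x"] by (simp add: br_simps)
  qed
  have vanish: "br x y = 0" if "br x (br x y) = 0" for x y
  proof -
    let ?w = "br x y"
    have wx: "br (P ?w) (P x) + br (Q ?w) (Q x) = 0" using that split[of ?w x] by (simp add: bracket_skew[of ?w x])
    then have "P (br (P ?w) (P x) + br (Q ?w) (Q x)) = 0" by (simp add: P_simps)
    then have "br (P ?w) (P x) = 0" using same[OF P_in P_in] same'[OF Q_in Q_in] by (simp add: P_simps P_Vp P_Vm)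
    with wx have "br (P ?w) x = 0" "br (Q ?w) x = 0"
      using decompose[of x] mixed[OF P_in Q_in] bracket_skew[of "Q ?w" "P x"]
      by (metis bilinear_radd[OF bracket] add.right_neutral, metis bilinear_radd[OF bracket] add_0 neg_0_equal_iff_equal)
    then have "b (P ?w) ?w = 0" "b (Q ?w) ?w = 0" using invariant[of "P ?w" x y] invariant[of "Q ?w" x y] by (simp_all add: b_simps)
    then have "b (P ?w) (P ?w) = 0" "b (Q ?w) (Q ?w) = 0" by (simp_all add: b_P b_Q P_in Q_in)
    then have "P ?w = 0" "Q ?w = 0"
      using metric_Vp(2)[OF P_in] inner_product_eq_0[OF inner_product_metric, of "P ?w"] b_neg_Vm(1)[OF Q_in] by auto
    then show ?thesis using decompose[of ?w] by simp
  qed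
  have "lcs (Suc (N - k)) = {0}" if "k \<le> N" for k
    using that
  proof (induction k)
    case 0
    have "br x 0 = 0" for x by (simp add: br_simps)
    then show ?case using nil by (auto simp: bracket_span_def)
  next
    case (Suc k)
    then have "lcs (Suc (N - k)) = {0}" "N - k = Suc (N - Suc k)"
      by (simp_all del: lower_central_series.simps)
    then have k: "lcs (Suc (Suc (N - Suc k))) = {0}" by metis
    have "br x y = 0" if "y \<in> lcs (N - Suc k)" for x y
    proof (rule vanish)
      show "br x (br x y) = 0" using lcs_step[OF lcs_step[OF that], of x x] k by blast
    qed
    then have "{br x y | x y. x \<in> UNIV \<and> y \<in> lcs (N - Suc k)} \<subseteq> {0}" by blast
    then have "lcs (Suc (N - Suc k)) \<subseteq> {0}"
      by (simp add: bracket_span_def) (metis (no_types, lifting) span_minimal subspace_single_0)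
    then show ?case using subspace_0[OF subspace_lcs[of "Suc (N - Suc k)"]] by blast
  qed
  from this[of N] have "lcs (Suc 0) = {0}" by simp
  then show ?thesis using lcs_step[of y 0 x] by (simp del: lower_central_series.simps(2))
qed

end

section \<open>The generalized tangent space of a generalized Kaehler Lie algebra\<close>

lemma hermitianD:
  assumes "hermitian_structure br J g"
  shows "linear J" "J (J x) = - x" "g (J x) (J y) = g x y" "inner_product g"
    "br x y + J (br (J x) y + br x (J y)) - br (J x) (J y) = 0"
  using assms by (auto simp: hermitian_structure_def integrable_complex_structure_def)

lemma hermitian_skew:
  assumes "hermitian_structure br J g"
  shows "g (J x) y = - g x (J y)"
  using hermitianD(3)[OF assms, of x "J y"] hermitianD(2)[OF assms, of y]
  by (simp add: bilinear_rneg[OF inner_product_bilinear[OF hermitianD(4)[OF assms]]])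

lemma bismut_torsion_eq:
  assumes "hermitian_structure br J g" and "bilinear br" and skew: "\<And>x y. br y x = - br x y"
  shows "bismut_torsion br J g [x, y, z]
    = - (g (br (J x) (J y)) z + g (br (J y) (J z)) x + g (br (J z) (J x)) y)"
proof -
  note g = inner_product_bilinear[OF hermitianD(4)[OF assms(1)]]
  have "g (br (J x) (J z)) y = - g (br (J z) (J x)) y"
    using skew[of "J x" "J z"] by (simp add: bilinear_lneg[OF g])
  then show ?thesis
    by (simp add: bismut_torsion_def ce_diff_2_form fundamental_form_def hermitianD(3)[OF assms(1)])
qed

text \<open>Integrability as the absence of a (3,0)-part: all three arguments of the form \<open>g [x, y] z\<close> are treated
  alike.\<close>

lemma integrable_pairing:
  assumes "hermitian_structure br J g"
  shows "g (br x y) z = g (br (J x) (J y)) z + g (br (J x) y) (J z) + g (br x (J y)) (J z)"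
proof -
  note g = inner_product_bilinear[OF hermitianD(4)[OF assms(1)]]
  have "g (br x y + J (br (J x) y + br x (J y)) - br (J x) (J y)) z = 0"
    by (simp add: hermitianD(5)[OF assms] bilinear_lzero[OF g])
  then show ?thesis
    by (simp add: bilinear_ladd[OF g] bilinear_lsub[OF g] hermitian_skew[OF assms])
qed

text \<open>The Bismut connection is metric, so this says that it preserves \<open>J\<close>: the left hand side
  is twice the pairing of the Bismut derivative \<open>\<nabla>\<^sub>x y\<close> with \<open>z\<close>.  The difference of the two sides is
  the sum of two instances of \<open>integrable_pairing\<close>.\<close>

lemma bismut_parallel:
  assumes H: "hermitian_structure br J g" and br: "bilinear br" and skew: "\<And>x y. br y x = - br x y"
  defines "c \<equiv> \<lambda>x y z. bismut_torsion br J g [x, y, z]"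
  shows "g (br x y) z - g (br y z) x + g (br z x) y + c x y z
    = g (br x (J y)) (J z) - g (br (J y) (J z)) x + g (br (J z) x) (J y) + c x (J y) (J z)"
proof -
  note g = inner_product_bilinear[OF hermitianD(4)[OF H]]
  show ?thesis
    unfolding c_def bismut_torsion_eq[OF H br skew]
    using integrable_pairing[OF H, of x y z] integrable_pairing[OF H, of z x y]
    by (simp add: hermitianD(2)[OF H] bilinear_lneg[OF br] bilinear_rneg[OF br] bilinear_lneg[OF g] bilinear_rneg[OF g])
qed

lemma bismut_no_30:
  assumes H: "hermitian_structure br J g" and br: "bilinear br" and skew: "\<And>x y. br y x = - br x y"
  defines "\<phi> \<equiv> \<lambda>x y z. g (br x y) z + g (br y z) x + g (br z x) y + bismut_torsion br J g [x, y, z]"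
  shows "\<phi> x y z = \<phi> (J x) (J y) z + \<phi> (J x) y (J z) + \<phi> x (J y) (J z)"
proof -
  note g = inner_product_bilinear[OF hermitianD(4)[OF H]]
  show ?thesis
    unfolding \<phi>_def bismut_torsion_eq[OF H br skew]
    using integrable_pairing[OF H, of x y z] integrable_pairing[OF H, of y z x] integrable_pairing[OF H, of z x y]
    by (simp add: hermitianD(2)[OF H] bilinear_lneg[OF br] bilinear_rneg[OF br] bilinear_lneg[OF g] bilinear_rneg[OF g])
qed

text \<open>The metric identifies \<open>\<gg>\<^sup>*\<close> with \<open>\<gg>\<close>, so a pair \<open>(X, \<xi>)\<close> stands for an element of \<open>\<gg> \<oplus> \<gg>\<^sup>*\<close>; \<open>pos\<close> and
  \<open>neg\<close> are the graphs of \<open>g\<close> and \<open>- g\<close>, the two eigenspaces of the generalized metric.\<close>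

definition pos :: "'a \<Rightarrow> 'a::real_vector \<times> 'a" where "pos x = (x, x)"
definition neg :: "'a \<Rightarrow> 'a::real_vector \<times> 'a" where "neg x = (x, - x)"

text \<open>Gualtieri's generalized complex structure: \<open>S\<close> on the graph of \<open>g\<close>, \<open>T\<close> on the graph of \<open>- g\<close>.\<close>

definition lift :: "('a \<Rightarrow> 'a) \<Rightarrow> ('a \<Rightarrow> 'a) \<Rightarrow> 'a::real_vector \<times> 'a \<Rightarrow> 'a \<times> 'a" where
  "lift S T p = pos (S ((1/2) *\<^sub>R (fst p + snd p))) + neg (T ((1/2) *\<^sub>R (fst p - snd p)))"

lemma pos_neg_decomposition: "\<exists>x y. p = pos x + neg y"
proof (intro exI)
  show "p = pos ((1/2) *\<^sub>R (fst p + snd p)) + neg ((1/2) *\<^sub>R (fst p - snd p))"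
    by (rule prod_eqI) (simp_all add: pos_def neg_def scaleR_2[symmetric] flip: scaleR_add_right scaleR_diff_right)
qed

lemma lift_pos_neg: "lift S T (pos x + neg y) = pos (S x) + neg (T y)"
proof -
  have "(x + y) + (x + - y) = 2 *\<^sub>R x" "(x + y) - (x + - y) = 2 *\<^sub>R y" by (simp_all add: scaleR_2)
  then show ?thesis by (simp add: lift_def pos_def neg_def)
qed

lemma pos_linear: "linear pos" and neg_linear: "linear neg"
  by (auto intro!: linearI simp: pos_def neg_def)

text \<open>The orthonormal basis \<open>E\<close> serves to represent linear forms by vectors.\<close>

locale gk_lie_algebra =
  fixes br :: "'a::real_vector \<Rightarrow> 'a \<Rightarrow> 'a" and A B :: "'a \<Rightarrow> 'a" and g :: "'a \<Rightarrow> 'a \<Rightarrow> real" and E :: "'a set"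
  assumes lie: "lie_bracket br"
    and gk: "generalized_kahler_structure br A B g"
    and E: "orthonormal g E" "span E = UNIV"
begin

lemma HA: "hermitian_structure br A g" and HB: "hermitian_structure br B g"
  using gk by (auto simp: generalized_kahler_structure_def)

lemma ip: "inner_product g" using HA by (rule hermitianD)

lemma bracket: "bilinear br" and bracket_self: "br x x = 0"
  and jacobi: "br x (br y z) + br y (br z x) + br z (br x y) = 0"
  using lie by (auto simp: lie_bracket_def)

lemma bracket_skew: "br y x = - br x y"
  using lie by (rule lie_bracket_skew)

lemma g_bil: "bilinear g" using ip by (rule inner_product_bilinear)

lemmas br_simps = bilinear_ladd[OF bracket] bilinear_radd[OF bracket] bilinear_lsub[OF bracket]
  bilinear_rsub[OF bracket] bilinear_lneg[OF bracket] bilinear_rneg[OF bracket]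
  bilinear_lmul[OF bracket] bilinear_rmul[OF bracket] bilinear_lzero[OF bracket] bilinear_rzero[OF bracket]

lemmas g_simps = bilinear_ladd[OF g_bil] bilinear_radd[OF g_bil] bilinear_lsub[OF g_bil]
  bilinear_rsub[OF g_bil] bilinear_lneg[OF g_bil] bilinear_rneg[OF g_bil]
  bilinear_lmul[OF g_bil] bilinear_rmul[OF g_bil] bilinear_lzero[OF g_bil] bilinear_rzero[OF g_bil]

lemmas A_simps = linear_add[OF hermitianD(1)[OF HA]] linear_diff[OF hermitianD(1)[OF HA]]
  linear_neg[OF hermitianD(1)[OF HA]] linear_scale[OF hermitianD(1)[OF HA]] linear_0[OF hermitianD(1)[OF HA]]
lemmas B_simps = linear_add[OF hermitianD(1)[OF HB]] linear_diff[OF hermitianD(1)[OF HB]]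
  linear_neg[OF hermitianD(1)[OF HB]] linear_scale[OF hermitianD(1)[OF HB]] linear_0[OF hermitianD(1)[OF HB]]

definition c :: "'a \<Rightarrow> 'a \<Rightarrow> 'a \<Rightarrow> real" where "c x y z = bismut_torsion br A g [x, y, z]"

lemma c_eq: "c x y z = - (g (br (A x) (A y)) z + g (br (A y) (A z)) x + g (br (A z) (A x)) y)"
  unfolding c_def by (rule bismut_torsion_eq[OF HA bracket bracket_skew])

lemma c_B: "bismut_torsion br B g [x, y, z] = - c x y z"
  using gk by (auto simp: generalized_kahler_structure_def c_def)

lemma c_cyclic: "c y z x = c x y z" by (simp add: c_eq)

lemma c_skew: "c y x z = - c x y z"
  by (simp add: c_eq bracket_skew[of "A y" "A x"] bracket_skew[of "A x" "A z"]
      bracket_skew[of "A z" "A y"] g_simps)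

lemma c_linear3: "linear (c x y)"
  by (auto intro!: linearI simp: c_eq g_simps br_simps A_simps algebra_simps)

lemma c_linear1: "linear (\<lambda>x. c x y z)"
  by (auto intro!: linearI simp: c_eq g_simps br_simps A_simps algebra_simps)

lemma c_linear2: "linear (\<lambda>y. c x y z)"
  by (auto intro!: linearI simp: c_eq g_simps br_simps A_simps algebra_simps)

lemma dc: "- c (br x y) z w + c (br x z) y w - c (br x w) y z
     - c (br y z) x w + c (br y w) x z - c (br z w) x y = 0"
proof -
  have "ce_diff br (bismut_torsion br A g) [x, y, z, w] = 0"
    using gk by (simp add: generalized_kahler_structure_def)
  then show ?thesis unfolding ce_diff_3_form c_def .
qed

definition pairing :: "'a \<times> 'a \<Rightarrow> 'a \<times> 'a \<Rightarrow> real" where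
  "pairing p q = g (fst p) (snd q) + g (snd p) (fst q)"

text \<open>The Courant bracket twisted by \<open>c\<close>, first as the 3-form obtained by pairing it with a third argument:
  it is totally skew, which is the invariance of the pairing.\<close>

definition courant_form :: "'a \<times> 'a \<Rightarrow> 'a \<times> 'a \<Rightarrow> 'a \<times> 'a \<Rightarrow> real" where
  "courant_form p q r = g (br (fst p) (fst q)) (snd r) + g (br (fst q) (fst r)) (snd p)
     + g (br (fst r) (fst p)) (snd q) + c (fst p) (fst q) (fst r)"

definition courant :: "'a \<times> 'a \<Rightarrow> 'a \<times> 'a \<Rightarrow> 'a \<times> 'a" where
  "courant p q = (br (fst p) (fst q), \<Sum>e\<in>E. courant_form p q (e, 0) *\<^sub>R e)"

lemma courant_form_cyclic: "courant_form q r p = courant_form p q r"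
  by (simp add: courant_form_def c_cyclic)

lemma courant_form_skew: "courant_form q p r = - courant_form p q r"
  by (simp add: courant_form_def c_skew[of "fst p"] bracket_skew[of "fst q" "fst p"]
      bracket_skew[of "fst p" "fst r"] bracket_skew[of "fst r" "fst q"] g_simps)

lemma courant_form_linear:
  "linear (courant_form p q)" "linear (\<lambda>q. courant_form p q r)" "linear (\<lambda>p. courant_form p q r)"
  by (auto intro!: linearI simp: courant_form_def g_simps br_simps algebra_simps
      linear_add[OF c_linear1] linear_scale[OF c_linear1] linear_add[OF c_linear2] linear_scale[OF c_linear2]
      linear_add[OF c_linear3] linear_scale[OF c_linear3])

lemma snd_courant: "g (snd (courant p q)) z = courant_form p q (z, 0)"
proof -
  have "linear (\<lambda>z. courant_form p q (z, 0))"
    by (auto intro!: linearI simp: courant_form_def g_simps br_simps algebra_simps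
      linear_add[OF c_linear3] linear_scale[OF c_linear3])
  from orthonormal_expansion_linear[OF g_bil E(1) _ this, of z]
  have "courant_form p q (z, 0) = (\<Sum>e\<in>E. g z e * courant_form p q (e, 0))" using E(2) by simp
  then show ?thesis
    by (simp add: courant_def linear_sum[OF linear_form_left[OF g_bil]] g_simps inner_product_sym[OF ip, of z] mult.commute)
qed

lemma pairing_courant: "pairing (courant p q) r = courant_form p q r"
proof -
  have "pairing (courant p q) r = g (br (fst p) (fst q)) (snd r) + courant_form p q (fst r, 0)"
    unfolding pairing_def snd_courant by (simp add: courant_def)
  then show ?thesis by (simp add: courant_form_def g_simps)
qed

lemma pairing_bilinear: "bilinear pairing"
  by (auto simp: bilinear_def linear_iff pairing_def g_simps algebra_simps)

lemma pairing_sym: "pairing p q = pairing q p"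
  by (simp add: pairing_def inner_product_sym[OF ip, of "fst p"] inner_product_sym[OF ip, of "snd p"])

lemma pairing_nondegenerate:
  assumes "\<And>r. pairing p r = pairing q r" shows "p = q"
proof (rule prod_eqI)
  show "fst p = fst q"
    using assms[of "(0, _)"] by (intro inner_product_nondegenerate[OF ip]) (simp add: pairing_def g_simps)
  show "snd p = snd q"
    using assms[of "(_, 0)"] by (intro inner_product_nondegenerate[OF ip]) (simp add: pairing_def g_simps)
qed

lemmas pairing_simps = bilinear_ladd[OF pairing_bilinear] bilinear_radd[OF pairing_bilinear] bilinear_lsub[OF pairing_bilinear]
  bilinear_rsub[OF pairing_bilinear] bilinear_lneg[OF pairing_bilinear] bilinear_rneg[OF pairing_bilinear]
  bilinear_lmul[OF pairing_bilinear] bilinear_rmul[OF pairing_bilinear] bilinear_lzero[OF pairing_bilinear] bilinear_rzero[OF pairing_bilinear]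

lemma courant_bilinear: "bilinear courant"
  unfolding bilinear_def linear_iff
  by (intro conjI allI; rule pairing_nondegenerate)
    (simp_all add: pairing_courant pairing_simps linear_add[OF courant_form_linear(2)] linear_add[OF courant_form_linear(3)]
      linear_scale[OF courant_form_linear(2)] linear_scale[OF courant_form_linear(3)])

lemma courant_invariant: "pairing (courant p q) r = pairing p (courant q r)"
  by (metis pairing_sym pairing_courant courant_form_cyclic)

lemma pairing_courant_courant:
  "pairing (courant q r) (courant p s) =
     g (br (fst s) (br (fst q) (fst r))) (snd p) + g (br (br (fst q) (fst r)) (fst p)) (snd s) + c (fst p) (fst s) (br (fst q) (fst r))
   + g (br (fst r) (br (fst p) (fst s))) (snd q) + g (br (br (fst p) (fst s)) (fst q)) (snd r) + c (fst q) (fst r) (br (fst p) (fst s))"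
proof -
  have "pairing (courant q r) (courant p s) = g (snd (courant p s)) (fst (courant q r)) + g (snd (courant q r)) (fst (courant p s))"
    by (simp add: pairing_def inner_product_sym[OF ip])
  then show ?thesis unfolding snd_courant by (simp add: courant_def courant_form_def g_simps)
qed

text \<open>Paired with \<open>s\<close>, the components along the four covectors are Jacobi identities of \<open>br\<close>, and the
  remaining part is \<open>dc\<close>.\<close>

lemma courant_jacobi: "courant p (courant q r) + courant q (courant r p) + courant r (courant p q) = 0"
proof (rule pairing_nondegenerate)
  fix s
  have 1: "pairing (courant p (courant q r)) s = - pairing (courant q r) (courant p s)" for p q r
  proof -
    have "pairing (courant q r) (courant p s) = courant_form (courant q r) p s"
      by (metis pairing_sym pairing_courant courant_form_cyclic)
    then show ?thesis by (simp add: pairing_courant courant_form_skew[of p "courant q r"])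
  qed
  have jac: "g (br x (br y z)) w + g (br y (br z x)) w + g (br z (br x y)) w = 0" for x y z w
    using arg_cong[OF jacobi[of x y z], of "\<lambda>v. g v w"] by (simp add: g_simps)
  obtain P p' where [simp]: "p = (P, p')" by (rule prod.exhaust)
  obtain Q q' where [simp]: "q = (Q, q')" by (rule prod.exhaust)
  obtain R r' where [simp]: "r = (R, r')" by (rule prod.exhaust)
  obtain S s' where [simp]: "s = (S, s')" by (rule prod.exhaust)
  have nest: "g (br (br x y) z) w = g (br z (br y x)) w" for x y z w
  proof -
    have "br (br x y) z = - br z (br x y)" by (rule bracket_skew)
    moreover have "br z (br x y) = - br z (br y x)"
      by (subst bracket_skew[of x y]) (rule bilinear_rneg[OF bracket])
    ultimately show ?thesis by simp
  qed
  have cyc: "c x y (br z w) = c (br z w) x y" for x y z w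
    by (rule c_cyclic)
  have swap1: "c (br Q S) R P = - c (br Q S) P R"
    using c_skew[of R P "br Q S"] by (simp only: cyc)
  have swap2: "c (br R P) Q S = - c (br P R) Q S"
  proof -
    have "c (- br P R) Q S = - c (br P R) Q S" by (rule linear_neg[OF c_linear1])
    then show ?thesis by (simp only: bracket_skew[of R P])
  qed
  show "pairing (courant p (courant q r) + courant q (courant r p) + courant r (courant p q)) s = pairing 0 s"
    unfolding pairing_simps 1 pairing_courant_courant
    using jac[of S Q R p'] jac[of S R P q'] jac[of S P Q r'] jac[of P R Q s'] dc[of P Q R S] swap1 swap2
    by (simp only: nest cyc \<open>p = _\<close> \<open>q = _\<close> \<open>r = _\<close> \<open>s = _\<close> fst_conv snd_conv pairing_simps)
qed


lemma courant_lie: "lie_bracket courant"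
proof -
  have "courant p p = 0" for p
    using courant_form_skew[of p p] pairing_courant
    by (intro pairing_nondegenerate) (simp add: pairing_simps)
  then show ?thesis using courant_bilinear courant_jacobi by (simp add: lie_bracket_def)
qed

text \<open>Integrability of \<open>lift A B\<close> says that \<open>courant_form\<close> has no (3,0)-part.  On vectors of a single kind this is
  \<open>bismut_no_30\<close>; when both kinds occur it follows from the parallelism of \<open>A\<close> or \<open>B\<close> under its Bismut
  connection.  The sign of \<open>c\<close> in \<open>courant_form\<close> fits \<open>A\<close> on \<open>pos\<close>, and \<open>B\<close> on \<open>neg\<close> because its torsion is
  \<open>- c\<close>.\<close>

lemma no_30_pos: "courant_form (pos x) (pos y) (pos z) = courant_form (pos (A x)) (pos (A y)) (pos z)
    + courant_form (pos (A x)) (pos y) (pos (A z)) + courant_form (pos x) (pos (A y)) (pos (A z))"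
  using bismut_no_30[OF HA bracket bracket_skew, of x y z]
  by (simp add: courant_form_def pos_def flip: c_def)

lemma no_30_neg: "courant_form (neg x) (neg y) (neg z) = courant_form (neg (B x)) (neg (B y)) (neg z)
    + courant_form (neg (B x)) (neg y) (neg (B z)) + courant_form (neg x) (neg (B y)) (neg (B z))"
  using bismut_no_30[OF HB bracket bracket_skew, of x y z]
  by (simp add: courant_form_def neg_def c_B g_simps)

lemma parallel_pos: "courant_form (pos (A x)) (pos (A y)) (neg z) = courant_form (pos x) (pos y) (neg z)"
proof -
  have "c x y z = c z x y" for x y z by (rule c_cyclic)
  then show ?thesis
    using bismut_parallel[OF HA bracket bracket_skew, of z x y]
    by (simp add: courant_form_def pos_def neg_def g_simps flip: c_def)
qed

lemma parallel_neg: "courant_form (pos x) (neg (B y)) (neg (B z)) = courant_form (pos x) (neg y) (neg z)"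
  using bismut_parallel[OF HB bracket bracket_skew, of x y z]
  by (simp add: courant_form_def pos_def neg_def g_simps c_B)

lemma no_30_mixed:
  "courant_form (pos (A x)) (pos y) (neg z) = - courant_form (pos x) (pos (A y)) (neg z)"
  "courant_form (pos x) (neg (B y)) (neg z) = - courant_form (pos x) (neg y) (neg (B z))"
proof -
  have "courant_form (pos (A x)) (pos (A (A y))) (neg z) = - courant_form (pos (A x)) (pos y) (neg z)"
    by (simp add: hermitianD(2)[OF HA] linear_neg[OF pos_linear] linear_neg[OF courant_form_linear(2)])
  then show "courant_form (pos (A x)) (pos y) (neg z) = - courant_form (pos x) (pos (A y)) (neg z)"
    by (simp add: parallel_pos)
  have "courant_form (pos x) (neg (B y)) (neg (B (B z))) = - courant_form (pos x) (neg (B y)) (neg z)"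
    by (simp add: hermitianD(2)[OF HB] linear_neg[OF neg_linear] linear_neg[OF courant_form_linear(1)])
  then show "courant_form (pos x) (neg (B y)) (neg z) = - courant_form (pos x) (neg y) (neg (B z))"
    by (simp add: parallel_neg)
qed

lemma lift_linear: "linear (lift A B)"
  by (auto intro!: linearI simp: lift_def A_simps B_simps linear_add[OF pos_linear] linear_add[OF neg_linear]
     linear_diff[OF neg_linear] linear_scale[OF pos_linear] linear_scale[OF neg_linear] algebra_simps)

lemma lift_sq: "lift A B (lift A B p) = - p"
proof -
  obtain x y where p: "p = pos x + neg y" using pos_neg_decomposition by blast
  show ?thesis unfolding p lift_pos_neg
    by (simp add: hermitianD(2)[OF HA] hermitianD(2)[OF HB] linear_neg[OF pos_linear] linear_neg[OF neg_linear])
qed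

lemma pairing_pos_neg: "pairing (pos x + neg y) (pos x' + neg y') = 2 * g x x' - 2 * g y y'"
  by (simp add: pairing_def pos_def neg_def g_simps)

lemma lift_orth: "pairing (lift A B p) (lift A B q) = pairing p q"
proof -
  obtain x y where p: "p = pos x + neg y" using pos_neg_decomposition by blast
  obtain x' y' where q: "q = pos x' + neg y'" using pos_neg_decomposition by blast
  show ?thesis unfolding p q lift_pos_neg pairing_pos_neg
    by (simp add: hermitianD(3)[OF HA] hermitianD(3)[OF HB])
qed

lemma lift_no_30:
  "courant_form p q r = courant_form (lift A B p) (lift A B q) r
     + courant_form (lift A B p) q (lift A B r) + courant_form p (lift A B q) (lift A B r)"
proof -
  let ?J = "lift A B"
  define F where "F p q r = courant_form p q r - courant_form (?J p) (?J q) r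
    - courant_form (?J p) q (?J r) - courant_form p (?J q) (?J r)" for p q r
  note lin = linear_add[OF courant_form_linear(1)] linear_add[OF courant_form_linear(2)]
     linear_add[OF courant_form_linear(3)] linear_add[OF lift_linear]
  have cyc: "F q r p = F p q r" for p q r
    unfolding F_def courant_form_cyclic[of q r p] courant_form_cyclic[of "?J q" r "?J p"]
      courant_form_cyclic[of "?J q" "?J r" p] courant_form_cyclic[of q "?J r" "?J p"] by simp
  have add: "F (p + p') q r = F p q r + F p' q r" "F p (q + q') r = F p q r + F p q' r"
    "F p q (r + r') = F p q r + F p q r'" for p p' q q' r r'
    by (simp_all add: F_def lin)
  have Jpos: "?J (pos x) = pos (A x)" and Jneg: "?J (neg x) = neg (B x)" for x
    using lift_pos_neg[of A B x 0] lift_pos_neg[of A B 0 x]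
    by (simp_all add: linear_0[OF pos_linear] linear_0[OF neg_linear] A_simps B_simps)
  have ppp: "F (pos x) (pos y) (pos z) = 0" for x y z
    using no_30_pos[of x y z] by (simp add: F_def Jpos)
  have nnn: "F (neg x) (neg y) (neg z) = 0" for x y z
    using no_30_neg[of x y z] by (simp add: F_def Jneg)
  have ppn: "F (pos x) (pos y) (neg z) = 0" for x y z
    using no_30_mixed(1)[of x y "B z"] by (simp add: F_def Jpos Jneg parallel_pos)
  have pnn: "F (pos x) (neg y) (neg z) = 0" for x y z
    using no_30_mixed(2)[of "A x" y z] by (simp add: F_def Jpos Jneg parallel_neg)
  obtain x x' where p: "p = pos x + neg x'" using pos_neg_decomposition by blast
  obtain y y' where q: "q = pos y + neg y'" using pos_neg_decomposition by blast
  obtain z z' where r: "r = pos z + neg z'" using pos_neg_decomposition by blast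
  have pnp: "F (pos x) (neg y) (pos z) = 0" "F (neg y) (pos x) (pos z) = 0"
    "F (neg x) (pos y) (neg z) = 0" "F (neg x) (neg y) (pos z) = 0" for x y z
    using ppn[of z x y] ppn[of x z y] pnn[of y z x] pnn[of z x y] cyc by metis+
  have "F p q r = 0" unfolding p q r add by (simp add: ppp nnn ppn pnn pnp)
  then show ?thesis by (simp add: F_def)
qed

lemma integrable_lift: "integrable_complex_structure courant (lift A B)"
proof -
  let ?J = "lift A B"
  have skew: "pairing (?J p) q = - pairing p (?J q)" for p q
    using lift_orth[of p "?J q"] by (simp add: lift_sq pairing_simps)
  have "courant p q + ?J (courant (?J p) q + courant p (?J q)) - courant (?J p) (?J q) = 0" for p q
  proof (rule pairing_nondegenerate)
    show "pairing (courant p q + ?J (courant (?J p) q + courant p (?J q)) - courant (?J p) (?J q)) r = pairing 0 r" for r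
      using lift_no_30[of p q r] by (simp add: pairing_simps skew pairing_courant)
  qed
  then show ?thesis by (simp add: integrable_complex_structure_def lift_linear lift_sq)
qed

text \<open>Since \<open>- B\<close> has the same torsion as \<open>B\<close>, the integrability of the second structure \<open>lift A (- B)\<close> comes for
  free.\<close>

lemma gk_neg: "gk_lie_algebra br A (\<lambda>x. - B x) g E"
proof -
  have H: "hermitian_structure br (\<lambda>x. - B x) g"
    using HB by (auto simp: hermitian_structure_def integrable_complex_structure_def g_simps br_simps
        B_simps linear_compose_neg algebra_simps)
  have "bismut_torsion br (\<lambda>x. - B x) g [x, y, z] = bismut_torsion br B g [x, y, z]" for x y z
    unfolding bismut_torsion_eq[OF H bracket bracket_skew] bismut_torsion_eq[OF HB bracket bracket_skew]
    by (simp add: br_simps)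
  then have "generalized_kahler_structure br A (\<lambda>x. - B x) g"
    using gk H unfolding generalized_kahler_structure_def by metis
  then show ?thesis using lie E by unfold_locales
qed

lemma courant_gk_pair: "quadratic_gk_pair courant pairing (lift A B) (lift A (\<lambda>x. - B x))"
proof -
  interpret n: gk_lie_algebra br A "\<lambda>x. - B x" g E by (rule gk_neg)
  show ?thesis
  proof
    fix p q r
    show "lie_bracket courant" by (rule courant_lie)
    show "bilinear pairing" by (rule pairing_bilinear)
    show "pairing p q = pairing q p" by (rule pairing_sym)
    show "pairing (courant p q) r = pairing p (courant q r)" by (rule courant_invariant)
    show "integrable_complex_structure courant (lift A B)" by (rule integrable_lift)
    show "integrable_complex_structure courant (lift A (\<lambda>x. - B x))" by (rule n.integrable_lift)
    show "pairing (lift A B p) (lift A B q) = pairing p q" by (rule lift_orth)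
    show "pairing (lift A (\<lambda>x. - B x) p) (lift A (\<lambda>x. - B x) q) = pairing p q" by (rule n.lift_orth)
    obtain x y where p: "p = pos x + neg y" using pos_neg_decomposition by blast
    show "lift A B (lift A (\<lambda>x. - B x) p) = lift A (\<lambda>x. - B x) (lift A B p)"
      unfolding p lift_pos_neg by (simp add: B_simps)
    show "0 < pairing (lift A B p) (lift A (\<lambda>x. - B x) p)" if "p \<noteq> 0"
    proof -
      have "x \<noteq> 0 \<or> y \<noteq> 0" using that p by (auto simp: pos_def neg_def zero_prod_def)
      then have "0 < g x x + g y y"
        using inner_product_pos[OF ip] inner_product_nonneg[OF ip] by (metis add_pos_nonneg add_nonneg_pos)
      then show ?thesis unfolding p lift_pos_neg pairing_pos_neg
        by (simp add: hermitianD(3)[OF HA] hermitianD(3)[OF HB] g_simps)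
    qed
  qed
qed

text \<open>After \<open>N\<close> brackets the vector component is gone.  From then on only the coadjoint action remains, which
  makes the covector vanish on ever larger terms of the lower central series.\<close>

lemma courant_nilpotent:
  assumes nil: "lower_central_series br UNIV N = {0}"
  shows "lower_central_series courant UNIV (N + N) = {0}"
proof -
  let ?n = "lower_central_series br UNIV" and ?q = "lower_central_series courant UNIV"
  have step: "br x y \<in> ?n (Suc k)" if "y \<in> ?n k" for x y k
    using that by (auto simp: bracket_span_def intro!: span_base)
  have sub: "subspace (?n k)" for k by (cases k) (simp_all add: bracket_span_def)
  have subq: "subspace (?q k)" for k by (cases k) (simp_all add: bracket_span_def)
  have 1: "?q k \<subseteq> {p. fst p \<in> ?n k}" for k
  proof (induction k)
    case (Suc k)
    have "subspace {p :: 'a \<times> 'a. fst p \<in> ?n (Suc k)}"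
      using sub[of "Suc k"] by (auto simp: subspace_def)
    moreover have "{courant x y |x y. x \<in> UNIV \<and> y \<in> ?q k} \<subseteq> {p. fst p \<in> ?n (Suc k)}"
    proof
      fix w assume "w \<in> {courant x y |x y. x \<in> UNIV \<and> y \<in> ?q k}"
      then obtain x y where w: "w = courant x y" and "y \<in> ?q k" by blast
      then have "fst y \<in> ?n k" using Suc by blast
      from step[OF this, of "fst x"] show "w \<in> {p. fst p \<in> ?n (Suc k)}" by (simp add: w courant_def)
    qed
    ultimately show ?case
      unfolding lower_central_series.simps(2)[of courant] bracket_span_def by (rule span_minimal[rotated])
  qed simp
  have 2: "?q (N + j) \<subseteq> {p. fst p = 0 \<and> (\<forall>z\<in>?n (N - j). g (snd p) z = 0)}" if "j \<le> N" for j
    using that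
  proof (induction j)
    case 0
    then show ?case using 1[of N] nil by (auto simp: g_simps)
  next
    case (Suc j)
    let ?S = "{p. fst p = 0 \<and> (\<forall>z\<in>?n (N - Suc j). g (snd p) z = 0)}"
    have "subspace ?S" by (auto simp: subspace_def g_simps)
    moreover have "{courant x y |x y. x \<in> UNIV \<and> y \<in> ?q (N + j)} \<subseteq> ?S"
    proof
      fix w assume "w \<in> {courant x y |x y. x \<in> UNIV \<and> y \<in> ?q (N + j)}"
      then obtain x y where w: "w = courant x y" and "y \<in> ?q (N + j)" by blast
      then have y: "fst y = 0" "\<forall>z\<in>?n (N - j). g (snd y) z = 0" using Suc by auto
      have "g (snd (courant x y)) z = 0" if z: "z \<in> ?n (N - Suc j)" for z
      proof -
        have "N - j = Suc (N - Suc j)" using Suc.prems by simp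
        then have "br (fst x) z \<in> ?n (N - j)" using step[OF z] by metis
        then have "g (br z (fst x)) (snd y) = 0"
          using y(2) by (simp add: bracket_skew[of z] g_simps inner_product_sym[OF ip, of _ "snd y"])
        then show ?thesis unfolding snd_courant
          by (simp add: courant_form_def y(1) g_simps br_simps linear_0[OF c_linear2])
      qed
      then show "w \<in> ?S" by (simp add: w) (simp add: courant_def y(1) br_simps)
    qed
    ultimately show ?case
      unfolding add_Suc_right lower_central_series.simps(2)[of courant] bracket_span_def by (rule span_minimal[rotated])
  qed
  have "p = 0" if "p \<in> ?q (N + N)" for p
  proof -
    have "fst p = 0" "g (snd p) (snd p) = 0" using 2[of N] that by auto
    then show ?thesis by (simp add: inner_product_eq_0[OF ip] prod_eq_iff)
  qed
  then show ?thesis using subspace_0[OF subq] by blast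
qed

theorem nilpotent_imp_abelian:
  assumes "nilpotent_on br UNIV"
  shows "br x y = 0"
proof -
  obtain N where N: "lower_central_series br UNIV N = {0}" using assms by (auto simp: nilpotent_on_def)
  have finE: "finite E" using E(1) by (simp add: orthonormal_def)
  let ?B = "(\<lambda>e. (e, 0)) ` E \<union> (\<lambda>e. (0, e)) ` E"
  have "(u, v) \<in> span ?B" for u v
  proof -
    have "linear (\<lambda>e::'a. (e, 0::'a))" "linear (\<lambda>e::'a. (0::'a, e))"
      by (auto intro!: linearI)
    from this[THEN linear_span_image, of E]
    have "(u, 0) \<in> span ((\<lambda>e. (e, 0::'a)) ` E)" "(0, v) \<in> span ((\<lambda>e. (0::'a, e)) ` E)"
      using E(2) by auto
    then have "(u, 0) + (0, v) \<in> span ?B"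
      by (intro span_add) (meson Un_upper1 Un_upper2 span_mono subsetD)+
    then show ?thesis by simp
  qed
  then have "span ?B = UNIV" by auto
  then have "courant (x, 0) (y, 0) = 0"
    using quadratic_gk_pair.nilpotent_imp_abelian[OF courant_gk_pair courant_nilpotent[OF N], of ?B] finE by blast
  then show ?thesis by (simp add: courant_def zero_prod_def)
qed

end

section \<open>Invariant nilpotent ideals\<close>

context gk_lie_algebra
begin

text \<open>To stay on the same type, \<open>H\<close> is extended by an abelian complement: with the orthogonal projection \<open>p\<close>
  onto \<open>H\<close>, the bracket \<open>br (p x) (p y)\<close> on the whole space is nilpotent and again generalized Kaehler,
  since \<open>p\<close> commutes with both complex structures.\<close>

lemma abelian_on_invariant_nilpotent_ideal:
  assumes ideal: "lie_ideal br H" and nil: "nilpotent_on br H"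
    and AH: "A ` H = H" and BH: "B ` H = H" and xy: "x \<in> H" "y \<in> H"
  shows "br x y = 0"
proof -
  have br_H: "br x y \<in> H" if "y \<in> H" for x y
    using ideal that by (auto simp: lie_ideal_def)
  have H0: "0 \<in> H" "subspace H" using ideal by (auto simp: lie_ideal_def intro: subspace_0)
  have finE: "finite E" using E(1) by (simp add: orthonormal_def)
  obtain D where D: "orthonormal g D" "span D = H"
    using orthonormal_basis_subspace[OF ip H0(2) _ finE, of "{}"] E(2) by (auto simp: orthonormal_def)
  define p where "p x = (\<Sum>e\<in>D. g x e *\<^sub>R e)" for x
  have p_lin: "linear p"
    by (auto intro!: linearI simp: p_def g_simps scaleR_add_left sum.distrib scaleR_sum_right)
  have p_in: "p x \<in> H" for x
    unfolding p_def D(2)[symmetric] by (intro span_sum span_scale span_base)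
  have p_id: "p x = x" if "x \<in> H" for x
    using orthonormal_expansion[OF g_bil D(1), of x] that D(2) by (simp add: p_def)
  have p_sym: "g (p x) z = g x (p z)" for x z
    by (simp add: p_def linear_sum[OF linear_form_left[OF g_bil]] linear_sum[OF linear_form_right[OF g_bil]] g_simps
        inner_product_sym[OF ip, of _ z] mult.commute)
  have g_p: "g w (p z) = g w z" if "w \<in> H" for w z
    using p_sym[of w z] p_id[OF that] by simp
  have commute: "p (J x) = J (p x)" if H: "hermitian_structure br J g" and JH: "J ` H = H" for J x
  proof (rule inner_product_nondegenerate[OF ip])
    fix z
    obtain h where h: "h \<in> H" "p z = J h" using p_in[of z] JH by blast
    have "g (p (J x)) z = g x h" by (simp add: p_sym h(2) hermitianD(3)[OF H])
    also have "\<dots> = g (p x) h" by (simp add: p_sym p_id[OF h(1)])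
    also have "\<dots> = g (J (p x)) (p z)" by (simp add: h(2) hermitianD(3)[OF H])
    also have "\<dots> = g (J (p x)) z" using JH p_in by (intro g_p) blast
    finally show "g (p (J x)) z = g (J (p x)) z" .
  qed
  define br' where "br' x y = br (p x) (p y)" for x y
  have br'_bil: "bilinear br'"
    by (auto simp: bilinear_def linear_iff br'_def linear_add[OF p_lin] linear_scale[OF p_lin] br_simps)
  have br'_in: "p (br (p x) (p y)) = br (p x) (p y)" for x y by (intro p_id br_H p_in)
  have lie': "lie_bracket br'"
    using br'_bil jacobi by (auto simp: lie_bracket_def br'_in br'_def bracket_self)
  have skew': "br' y x = - br' x y" for x y by (simp add: br'_def bracket_skew[of "p y"])
  have herm': "hermitian_structure br' J g" if H: "hermitian_structure br J g" and JH: "J ` H = H" for J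
    using H hermitianD(5)[OF H] unfolding hermitian_structure_def integrable_complex_structure_def
    by (simp add: br'_def commute[OF H JH])
  have tors: "bismut_torsion br' J g [x, y, z] = bismut_torsion br J g [p x, p y, p z]"
    if H: "hermitian_structure br J g" and JH: "J ` H = H" for J x y z
    unfolding bismut_torsion_eq[OF H bracket bracket_skew] bismut_torsion_eq[OF herm'[OF H JH] br'_bil skew']
    by (simp add: br'_def commute[OF H JH, symmetric] g_p br_H p_in)
  have "generalized_kahler_structure br' A B g"
    unfolding generalized_kahler_structure_def
  proof (intro conjI allI)
    show "hermitian_structure br' A g" "hermitian_structure br' B g"
      using herm' HA HB AH BH by auto
    show "bismut_torsion br' A g [x, y, z] = - bismut_torsion br' B g [x, y, z]" for x y z
      unfolding tors[OF HA AH] tors[OF HB BH] c_B c_def by simp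
    show "ce_diff br' (bismut_torsion br' A g) [x, y, z, w] = 0" for x y z w
      unfolding ce_diff_3_form tors[OF HA AH] br'_def br'_in using dc[of "p x" "p y" "p z" "p w"]
      by (simp only: c_def)
  qed
  then interpret r: gk_lie_algebra br' A B g E
    using lie' E by unfold_locales
  obtain N where N: "lower_central_series br H N = {0}" using nil by (auto simp: nilpotent_on_def)
  have lcs_H: "lower_central_series br H k \<subseteq> H" for k
  proof (induction k)
    case (Suc k)
    then have "{br x y |x y. x \<in> H \<and> y \<in> lower_central_series br H k} \<subseteq> H" using br_H by blast
    then show ?case using H0(2) by (simp add: bracket_span_def span_minimal)
  qed simp
  have "lower_central_series br' UNIV (Suc k) \<subseteq> lower_central_series br H (Suc k)" for k
  proof (induction k)
    case 0
    have "{br' x y |x y. x \<in> UNIV \<and> y \<in> UNIV} \<subseteq> {br x y |x y. x \<in> H \<and> y \<in> H}"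
      using p_in by (auto simp: br'_def)
    then show ?case by (simp only: lower_central_series.simps bracket_span_def span_mono)
  next
    case (Suc k)
    have "{br' x y |x y. x \<in> UNIV \<and> y \<in> lower_central_series br' UNIV (Suc k)}
      \<subseteq> {br x y |x y. x \<in> H \<and> y \<in> lower_central_series br H (Suc k)}"
    proof
      fix w assume "w \<in> {br' x y |x y. x \<in> UNIV \<and> y \<in> lower_central_series br' UNIV (Suc k)}"
      then obtain x y where w: "w = br' x y" and "y \<in> lower_central_series br' UNIV (Suc k)" by blast
      then have y: "y \<in> lower_central_series br H (Suc k)" using Suc by blast
      then have "p y = y" using lcs_H by (intro p_id) blast
      then show "w \<in> {br x y |x y. x \<in> H \<and> y \<in> lower_central_series br H (Suc k)}"
        using w y p_in by (auto simp: br'_def)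
    qed
    then show ?case
      unfolding lower_central_series.simps(2)[of _ _ "Suc k"] bracket_span_def by (rule span_mono)
  qed
  from this[of N] have "lower_central_series br' UNIV (Suc N) \<subseteq> lower_central_series br H (Suc N)" .
  also have "{br x y |x y. x \<in> H \<and> y \<in> lower_central_series br H N} \<subseteq> {0}"
    using N by (auto simp: br_simps)
  then have "lower_central_series br H (Suc N) \<subseteq> {0}"
    unfolding lower_central_series.simps bracket_span_def by (rule span_minimal) (rule subspace_single_0)
  finally have "lower_central_series br' UNIV (Suc N) \<subseteq> {0}" .
  then have "lower_central_series br' UNIV (Suc N) = {0}"
    by (auto simp: bracket_span_def span_zero)
  then have "nilpotent_on br' UNIV" unfolding nilpotent_on_def by blast
  then have "br' x y = 0" by (rule r.nilpotent_imp_abelian)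
  then show ?thesis using xy by (simp add: br'_def p_id)
qed

end

section \<open>Nilradicals of codimension two\<close>

context gk_lie_algebra
begin

text \<open>\<open>ad u\<close> and \<open>ad w\<close> restricted to \<open>H\<close> satisfy \<open>[ad u, ad w] = l ad w\<close>, so \<open>ad w\<close> is nilpotent on \<open>H\<close>.  As \<open>H\<close> is abelian,
  brackets within \<open>H + \<real>w\<close> only involve \<open>ad w\<close>, so this ideal is nilpotent and lies in \<open>H\<close>.\<close>

lemma mem_nilradical:
  assumes nr: "is_nilradical br H" and abelian: "\<And>x y. x \<in> H \<Longrightarrow> y \<in> H \<Longrightarrow> br x y = 0"
    and comm: "br u w = l *\<^sub>R w" and l: "l \<noteq> 0"
    and mod_H: "\<And>x. \<exists>t. br x w - t *\<^sub>R w \<in> H"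
  shows "w \<in> H"
proof -
  have br_H: "br x y \<in> H" if "y \<in> H" for x y
    using nr that by (auto simp: is_nilradical_def lie_ideal_def)
  have H: "subspace H" using nr by (auto simp: is_nilradical_def lie_ideal_def)
  have finE: "finite E" using E(1) by (simp add: orthonormal_def)
  obtain D where D: "orthonormal g D" "span D = H"
    using orthonormal_basis_subspace[OF ip H _ finE, of "{}"] E(2) by (auto simp: orthonormal_def)
  have "br u (br w x) - br w (br u x) = l *\<^sub>R br w x" for x
  proof -
    have "br u (br w x) + br w (br x u) + br x (br u w) = 0" by (rule jacobi)
    moreover have "br w (br x u) = - br w (br u x)" using bracket_skew[of x u] by (simp add: br_simps)
    moreover have "br x (br u w) = - (l *\<^sub>R br w x)" using bracket_skew[of x w] by (simp add: comm br_simps)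
    ultimately show ?thesis by (simp add: algebra_simps add_eq_0_iff)
  qed
  moreover have "br x ` span D \<subseteq> span D" for x using br_H by (auto simp: D(2))
  ultimately obtain k where k: "\<forall>x\<in>H. (br w ^^ k) x = 0"
    using commutator_multiple_imp_nilpotent[OF ip D(1) linear_form_right[OF bracket, of u] _
        linear_form_right[OF bracket, of w] _ _ l] D(2) by blast
  define I where "I = {h + t *\<^sub>R w | h t. h \<in> H}"
  have I_sub: "subspace I"
    unfolding subspace_def
  proof (intro conjI ballI allI)
    show "0 \<in> I" unfolding I_def using subspace_0[OF H] by (auto intro!: exI[of _ 0])
    fix x y assume "x \<in> I" "y \<in> I"
    then obtain h t h' t' where *: "x = h + t *\<^sub>R w" "y = h' + t' *\<^sub>R w" "h \<in> H" "h' \<in> H"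
      unfolding I_def by blast
    have "x + y = (h + h') + (t + t') *\<^sub>R w" by (simp add: * scaleR_add_left)
    then show "x + y \<in> I" unfolding I_def using subspace_add[OF H *(3,4)] by blast
  next
    fix c x assume "x \<in> I"
    then obtain h t where *: "x = h + t *\<^sub>R w" "h \<in> H" unfolding I_def by blast
    have "c *\<^sub>R x = c *\<^sub>R h + (c * t) *\<^sub>R w" by (simp add: * scaleR_add_right)
    then show "c *\<^sub>R x \<in> I" unfolding I_def using subspace_scale[OF H *(2)] by blast
  qed
  have H_I: "H \<subseteq> I"
  proof
    fix h assume "h \<in> H"
    moreover have "h = h + 0 *\<^sub>R w" by simp
    ultimately show "h \<in> I" unfolding I_def by blast
  qed
  have w_I: "w \<in> I"
  proof -
    have "w = 0 + 1 *\<^sub>R w" by simp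
    then show ?thesis unfolding I_def using subspace_0[OF H] by blast
  qed
  have "br x y \<in> I" if "y \<in> I" for x y
  proof -
    obtain h t where *: "y = h + t *\<^sub>R w" "h \<in> H" using \<open>y \<in> I\<close> unfolding I_def by blast
    obtain s where s: "br x w - s *\<^sub>R w \<in> H" using mod_H by blast
    have "br x y = (br x h + t *\<^sub>R (br x w - s *\<^sub>R w)) + (t * s) *\<^sub>R w"
      by (simp add: * br_simps algebra_simps)
    moreover have "br x h + t *\<^sub>R (br x w - s *\<^sub>R w) \<in> H"
      using s br_H[OF *(2)] H by (intro subspace_add subspace_scale)
    ultimately show ?thesis unfolding I_def by blast
  qed
  then have I_ideal: "lie_ideal br I" using I_sub by (auto simp: lie_ideal_def)
  have I_br: "br x y \<in> H \<and> (y \<in> H \<longrightarrow> (\<exists>t. br x y = br w (t *\<^sub>R y)))" if xy: "x \<in> I" "y \<in> I" for x y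
  proof -
    obtain h t h' t' where *: "x = h + t *\<^sub>R w" "y = h' + t' *\<^sub>R w" "h \<in> H" "h' \<in> H"
      using xy unfolding I_def by blast
    have "br x y = t' *\<^sub>R br h w + t *\<^sub>R br w h'"
      by (simp add: *(1,2) br_simps abelian[OF *(3,4)] bracket_self)
    also have "br h w = - br w h" by (rule bracket_skew)
    finally have eq: "br x y = - (t' *\<^sub>R br w h) + t *\<^sub>R br w h'" by simp
    have 1: "br x y \<in> H"
      unfolding eq using br_H[OF *(3)] br_H[OF *(4)] H by (intro subspace_add subspace_neg subspace_scale)
    have "br x y = br w (t *\<^sub>R y)" if "y \<in> H"
      using abelian[OF *(3) that] by (simp add: *(1) br_simps)
    with 1 show ?thesis by blast
  qed
  have lcs: "lower_central_series br I (Suc j) \<subseteq> (br w ^^ j) ` H" for j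
  proof (induction j)
    case 0
    have "{br x y |x y. x \<in> I \<and> y \<in> I} \<subseteq> H" using I_br by blast
    then show ?case using H by (simp add: bracket_span_def span_minimal)
  next
    case (Suc j)
    have lin: "linear (br w ^^ i)" for i
      by (induction i) (simp_all only: funpow.simps linear_id linear_compose[OF _ linear_form_right[OF bracket, of w]])
    have in_H: "(br w ^^ i) ` H \<subseteq> H" for i using br_H by (induction i) auto
    have "{br x y |x y. x \<in> I \<and> y \<in> lower_central_series br I (Suc j)} \<subseteq> (br w ^^ Suc j) ` H"
    proof
      fix z assume "z \<in> {br x y |x y. x \<in> I \<and> y \<in> lower_central_series br I (Suc j)}"
      then obtain x y where z: "z = br x y" "x \<in> I" "y \<in> (br w ^^ j) ` H" using Suc by blast
      then have "y \<in> H" "y \<in> I" using in_H H_I by blast+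
      then obtain t where t: "z = br w (t *\<^sub>R y)" using I_br[OF z(2)] z(1) by blast
      obtain h where h: "h \<in> H" "y = (br w ^^ j) h" using z(3) by blast
      have "z = (br w ^^ Suc j) (t *\<^sub>R h)" by (simp add: t h(2) linear_scale[OF lin])
      then show "z \<in> (br w ^^ Suc j) ` H" using h(1) subspace_scale[OF H] by blast
    qed
    then show ?case
      unfolding lower_central_series.simps(2)[of _ _ "Suc j"] bracket_span_def
      by (rule span_minimal) (rule linear_subspace_image[OF lin H])
  qed
  have "lower_central_series br I (Suc k) \<subseteq> {0}" using lcs[of k] k by auto
  then have "lower_central_series br I (Suc k) = {0}" by (auto simp: bracket_span_def span_zero)
  then have "nilpotent_on br I" unfolding nilpotent_on_def by blast
  then show ?thesis using nr I_ideal w_I by (auto simp: is_nilradical_def)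
qed

lemma adapted_frame:
  assumes H: "subspace H" and AH: "A ` H = H" and dim: "dim (UNIV :: 'a set) = dim H + 2"
  obtains D e where "orthonormal g D" "span D = H" "span (insert e (insert (A e) D)) = UNIV"
    "g e e = 1" "g (A e) (A e) = 1" "g e (A e) = 0"
    "\<And>h. h \<in> H \<Longrightarrow> g h e = 0" "\<And>h. h \<in> H \<Longrightarrow> g h (A e) = 0"
proof -
  have finE: "finite E" using E(1) by (simp add: orthonormal_def)
  have ext: "\<exists>F. G \<subseteq> F \<and> orthonormal g F \<and> span F = UNIV" if "orthonormal g G" for G
    using orthonormal_basis_subspace[OF ip subspace_UNIV _ finE that] E(2) by simp
  obtain D where D: "orthonormal g D" "span D = H"
    using orthonormal_basis_subspace[OF ip H _ finE, of "{}"] E(2) by (auto simp: orthonormal_def)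
  have finD: "finite D" using D(1) by (simp add: orthonormal_def)
  have card: "card F = card D + 2" if "orthonormal g F" "span F = UNIV" for F
    using dim_orthonormal[OF ip that(1)] dim_orthonormal[OF ip D(1)] that(2) D(2) dim by simp
  obtain F where F: "D \<subseteq> F" "orthonormal g F" "span F = UNIV" using ext[OF D(1)] by blast
  then obtain e where e: "e \<in> F" "e \<notin> D" using card[OF F(2,3)] by (metis add_cancel_right_right subsetI subset_antisym zero_neq_numeral)
  have ee: "g e e = 1" using F(2) e by (simp add: orthonormal_def)
  have De: "g d e = 0" if "d \<in> D" for d using F(1,2) e that by (auto simp: orthonormal_def)
  have He: "g h e = 0" if "h \<in> H" for h
    using linear_eq_0_on_span[OF linear_form_left[OF g_bil, of e] De] that D(2) by blast
  have HAe: "g h (A e) = 0" if "h \<in> H" for h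
  proof -
    have "A h \<in> H" using AH that by blast
    then show ?thesis using He[of "A h"] hermitian_skew[OF HA, of h e] by simp
  qed
  have AeAe: "g (A e) (A e) = 1" using ee by (simp add: hermitianD(3)[OF HA])
  have eAe: "g e (A e) = 0"
    using hermitian_skew[OF HA, of e e] inner_product_sym[OF ip, of e "A e"] by simp
  have D_H: "d \<in> D \<Longrightarrow> d \<in> H" for d using D(2) span_base by blast
  have on: "orthonormal g (insert e (insert (A e) D))"
    using D(1) ee AeAe eAe He[OF D_H] HAe[OF D_H] inner_product_sym[OF ip]
    unfolding orthonormal_def by (smt (verit) finite_insert insertE)
  obtain G where G: "insert e (insert (A e) D) \<subseteq> G" "orthonormal g G" "span G = UNIV" using ext[OF on] by blast
  have "A e \<notin> D" using HAe[OF D_H, of "A e"] AeAe by auto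
  moreover have "e \<noteq> A e" using eAe ee by auto
  ultimately have "card (insert e (insert (A e) D)) = card G"
    using e(2) finD card[OF G(2,3)] by simp
  then have "insert e (insert (A e) D) = G"
    using G(1,2) by (intro card_subset_eq) (auto simp: orthonormal_def)
  then show ?thesis using that[OF D, of e] G(3) ee AeAe eAe He HAe by blast
qed

text \<open>The frame \<open>e\<close>, \<open>f = A e\<close> spans the orthogonal complement of \<open>H\<close>.  The torsion components are eliminated
  one type at a time: on \<open>H\<close> because \<open>H\<close> is abelian, on \<open>e, f\<close> and a vector of \<open>H\<close> by comparing \<open>A\<close> with \<open>B\<close>, on
  one of \<open>e, f\<close> and two vectors of \<open>H\<close> by a trace of \<open>dc = 0\<close>.\<close>

theorem kahler_of_codim_2:
  assumes nr: "is_nilradical br H" and AH: "A ` H = H" and BH: "B ` H = H"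
    and dim: "dim (UNIV :: 'a set) = dim H + 2"
  shows "kahler_structure br A g"
proof -
  have ideal: "lie_ideal br H" "nilpotent_on br H" using nr by (auto simp: is_nilradical_def)
  have H: "subspace H" using ideal(1) by (simp add: lie_ideal_def)
  have br_H: "br x y \<in> H" "br y x \<in> H" if "y \<in> H" for x y
    using ideal(1) that bracket_skew[of y x] subspace_neg[OF H] by (auto simp: lie_ideal_def)
  have abelian: "br x y = 0" if "x \<in> H" "y \<in> H" for x y
    using abelian_on_invariant_nilpotent_ideal[OF ideal AH BH that] .
  obtain D e where D: "orthonormal g D" "span D = H" and UN: "span (insert e (insert (A e) D)) = UNIV"
    and ee: "g e e = 1" "g (A e) (A e) = 1" "g e (A e) = 0"
    and He: "\<And>h. h \<in> H \<Longrightarrow> g h e = 0" "\<And>h. h \<in> H \<Longrightarrow> g h (A e) = 0"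
    using adapted_frame[OF H AH dim] by metis
  define f where "f = A e"
  note ee = ee[folded f_def] and He = He[folded f_def]
  have Ae: "A e = f" and Af: "A f = - e" by (simp_all add: f_def hermitianD(2)[OF HA])
  have eH: "g e h = 0" "g f h = 0" if "h \<in> H" for h
    using He[OF that] inner_product_sym[OF ip] by metis+
  have fe: "g f e = 0" using ee(3) inner_product_sym[OF ip] by metis
  have A_H: "A h \<in> H" and B_H: "B h \<in> H" if "h \<in> H" for h using AH BH that by blast+

  have frame: "\<exists>h s t. h \<in> H \<and> x = h + s *\<^sub>R e + t *\<^sub>R f" for x
  proof -
    have "x \<in> span (insert e (insert f D))" using UN by (simp add: f_def)
    then obtain s where "x - s *\<^sub>R e \<in> span (insert f D)" using span_breakdown_eq by blast
    then obtain t where "x - s *\<^sub>R e - t *\<^sub>R f \<in> span D" using span_breakdown_eq by blast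
    then show ?thesis using D(2) by (intro exI[of _ "x - s *\<^sub>R e - t *\<^sub>R f"] exI[of _ s] exI[of _ t]) simp
  qed

  have Be: "\<exists>s. B e = s *\<^sub>R f \<and> s * s = 1"
  proof -
    obtain h s t where x: "h \<in> H" "B e = h + s *\<^sub>R e + t *\<^sub>R f" using frame by blast
    have "g (B e) e = 0"
      using hermitian_skew[OF HB, of e e] inner_product_sym[OF ip, of e "B e"] by simp
    then have s: "s = 0" by (simp add: x g_simps He ee fe)
    have "g (B e) h = 0"
      using hermitian_skew[OF HB, of e h] eH(1)[OF B_H[OF x(1)]] by simp
    then have "g h h = 0" using s by (simp add: x g_simps eH)
    then have h: "h = 0" by (simp add: inner_product_eq_0[OF ip])
    have "g (B e) (B e) = 1" by (simp add: hermitianD(3)[OF HB] ee)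
    then have "t * t = 1" by (simp add: x h s g_simps ee)
    then show ?thesis using x h s by auto
  qed
  \<comment> \<open>The sign \<open>\<epsilon>\<close> enters the torsion of \<open>B\<close> squared, so it need not be determined.\<close>
  then obtain \<epsilon> where Be: "B e = \<epsilon> *\<^sub>R f" and \<epsilon>: "\<epsilon> * \<epsilon> = 1" by blast
  have Bf: "B f = - (\<epsilon> *\<^sub>R e)"
  proof -
    have "f = (\<epsilon> * \<epsilon>) *\<^sub>R f" by (simp add: \<epsilon>)
    also have "\<dots> = \<epsilon> *\<^sub>R B e" by (simp add: Be)
    finally have "B f = B (\<epsilon> *\<^sub>R B e)" by simp
    then show ?thesis by (simp add: B_simps hermitianD(2)[OF HB])
  qed

  have c_efH: "c e f y = - g (br e f) y" if "y \<in> H" for y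
    using br_H[OF A_H[OF that]] He by (simp add: c_eq Ae Af br_simps g_simps bracket_skew[of f e])
  have w_perp: "g (br e f) y = 0" if "y \<in> H" for y
  proof -
    have "- c e f y = - g (br e f) y"
      unfolding c_B[symmetric] bismut_torsion_eq[OF HB bracket bracket_skew]
      using br_H[OF B_H[OF that]] He \<epsilon>
      by (simp add: Be Bf br_simps g_simps bracket_skew[of f e] flip: mult.assoc)
    then show ?thesis using c_efH[OF that] by simp
  qed

  have w0: "br e f = 0"
  proof (rule ccontr)
    assume w: "br e f \<noteq> 0"
    obtain h s t where x: "h \<in> H" "br e f = h + s *\<^sub>R e + t *\<^sub>R f" using frame by blast
    have "g h h = 0" using w_perp[OF x(1)] by (simp add: x g_simps eH)
    then have "h = 0" by (simp add: inner_product_eq_0[OF ip])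
    with x(2) have st: "br e f = s *\<^sub>R e + t *\<^sub>R f" by simp
    \<comment> \<open>One of \<open>e\<close> and \<open>f\<close> has \<open>br e f\<close> as an eigenvector with nonzero eigenvalue.\<close>
    have ew: "br e (br e f) = t *\<^sub>R br e f"
      by (subst st) (simp add: br_simps bracket_self)
    have fw: "br f (br e f) = (- s) *\<^sub>R br e f"
      by (subst st) (simp add: br_simps bracket_self bracket_skew[of f e])
    have mod_H: "\<exists>r. br x (br e f) - r *\<^sub>R br e f \<in> H" for x
    proof -
      obtain h' p q where x: "h' \<in> H" "x = h' + p *\<^sub>R e + q *\<^sub>R f" using frame by blast
      have "br x (br e f) - (p * t - q * s) *\<^sub>R br e f = br h' (br e f)"
        by (simp add: x(2) bilinear_ladd[OF bracket] bilinear_lmul[OF bracket] ew fw scaleR_diff_left)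
      then show ?thesis using br_H(2)[OF x(1)] by metis
    qed
    have "s \<noteq> 0 \<or> t \<noteq> 0" using w st by auto
    then have "br e f \<in> H"
      using mem_nilradical[OF nr abelian ew _ mod_H] mem_nilradical[OF nr abelian fw _ mod_H] by auto
    from w_perp[OF this] show False using w by (simp add: inner_product_eq_0[OF ip])
  qed

  define a where "a = br e"
  define b where "b = br f"
  have a_lin: "linear a" and b_lin: "linear b" unfolding a_def b_def by (rule linear_form_right[OF bracket])+
  have a_H: "a x \<in> H" and b_H: "b x \<in> H" if "x \<in> H" for x using br_H[OF that] by (simp_all add: a_def b_def)
  have c_e: "c e x y = g (b (A y)) x - g (b (A x)) y" if "x \<in> H" "y \<in> H" for x y
    using abelian[OF A_H[OF that(1)] A_H[OF that(2)]]
    by (simp add: c_eq Ae b_def g_simps bracket_skew[of "A y" f])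
  have c_f: "c f x y = g (a (A x)) y - g (a (A y)) x" if "x \<in> H" "y \<in> H" for x y
    using abelian[OF A_H[OF that(1)] A_H[OF that(2)]]
    by (simp add: c_eq Af a_def g_simps br_simps bracket_skew[of "A y" e])
  \<comment> \<open>This is \<open>dc = 0\<close> at \<open>e, f, y, A y\<close>.\<close>
  have skt: "g (a (A (a (A y)))) y - g (a (A y)) (a (A y)) - g (a (A (a y))) (A y) - g (a y) (a y)
      + (g (b (A (b (A y)))) y - g (b (A y)) (b (A y)) - g (b (A (b y))) (A y) - g (b y) (b y)) = 0"
    if y: "y \<in> H" for y
  proof -
    have "c (br e f) y (A y) = 0" "c (br y (A y)) e f = 0"
      using w0 abelian[OF y A_H[OF y]] by (simp_all add: linear_0[OF c_linear1])
    then have "c (a y) f (A y) - c (a (A y)) f y - c (b y) e (A y) + c (b (A y)) e y = 0"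
      using dc[of e f y "A y"] by (simp add: a_def b_def)
    then have "- c f (a y) (A y) + c f (a (A y)) y + c e (b y) (A y) - c e (b (A y)) y = 0"
      by (simp add: c_skew[of "a y" f] c_skew[of "a (A y)" f] c_skew[of "b y" e] c_skew[of "b (A y)" e])
    then show ?thesis
      by (simp add: c_f c_e y A_H a_H b_H hermitianD(2)[OF HA] linear_neg[OF a_lin] linear_neg[OF b_lin] g_simps)
  qed

  have isometry: "(\<Sum>e\<in>D. h (A e) (A e)) = (\<Sum>e\<in>D. h e e)" if "bilinear h" for h :: "'a \<Rightarrow> 'a \<Rightarrow> real"
    using contraction_isometry_invariant[OF ip D(1) hermitianD(1)[OF HA] _ hermitianD(3)[OF HA] that] AH D(2) by simp
  \<comment> \<open>Replacing \<open>y\<close> by \<open>A y\<close> in two of the sums merges the four terms into \<open>2 (tr ((m A)\<^sup>2) - |m A|\<^sup>2)\<close>.\<close>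
  have fold: "(\<Sum>y\<in>D. g (m (A (m (A y)))) y - g (m (A y)) (m (A y)) - g (m (A (m y))) (A y) - g (m y) (m y))
      = - (\<Sum>y\<in>D. \<Sum>z\<in>D. (g (m (A y)) z - g (m (A z)) y)\<^sup>2)"
    if m: "linear m" "\<And>x. x \<in> H \<Longrightarrow> m x \<in> H" for m
  proof -
    have mA: "linear (m \<circ> A)" using linear_compose[OF hermitianD(1)[OF HA] m(1)] .
    have mm: "linear (\<lambda>x. m (A (m x)))" using linear_compose[OF m(1) mA] by (simp add: o_def)
    have "bilinear (\<lambda>x y. g (m (A (m x))) (A y))"
      by (auto simp: bilinear_def linear_iff A_simps g_simps linear_add[OF mm] linear_scale[OF mm])
    from isometry[OF this]
    have 1: "(\<Sum>y\<in>D. g (m (A (m y))) (A y)) = - (\<Sum>y\<in>D. g (m (A (m (A y)))) y)"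
      by (simp add: hermitianD(2)[OF HA] g_simps sum_negf)
    have "bilinear (\<lambda>x y. g (m x) (m y))"
      by (auto simp: bilinear_def linear_iff g_simps linear_add[OF m(1)] linear_scale[OF m(1)])
    from isometry[OF this] have 2: "(\<Sum>y\<in>D. g (m (A y)) (m (A y))) = (\<Sum>y\<in>D. g (m y) (m y))" .
    have "(m \<circ> A) ` span D \<subseteq> span D" using m(2) A_H by (auto simp: D(2))
    from trace_square_defect[OF ip D(1) mA this] show ?thesis
      using 1 2 by (simp add: sum_subtractf)
  qed
  let ?S = "\<lambda>m. \<Sum>y\<in>D. \<Sum>z\<in>D. (g (m (A y)) z - g (m (A z)) y)\<^sup>2"
  have D_H: "y \<in> H" if "y \<in> D" for y using D(2) span_base that by blast
  let ?\<Phi> = "\<lambda>m y. g (m (A (m (A y)))) y - g (m (A y)) (m (A y)) - g (m (A (m y))) (A y) - g (m y) (m y)"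
  have "(\<Sum>y\<in>D. ?\<Phi> a y) = - ?S a" "(\<Sum>y\<in>D. ?\<Phi> b y) = - ?S b"
    by (rule fold[OF a_lin], rule a_H, assumption) (rule fold[OF b_lin], rule b_H, assumption)
  moreover have "(\<Sum>y\<in>D. ?\<Phi> a y + ?\<Phi> b y) = 0"
    by (intro sum.neutral ballI skt D_H)
  ultimately have "- ?S a + - ?S b = 0" by (simp only: sum.distrib)
  moreover have "?S a \<ge> 0" "?S b \<ge> 0" by (intro sum_nonneg zero_le_power2)+
  ultimately have S0: "?S a = 0" "?S b = 0" by linarith+
  have sym: "g (m (A y)) z = g (m (A z)) y" if "?S m = 0" "y \<in> D" "z \<in> D" for m y z
  proof -
    have fin: "finite D" using D(1) by (simp add: orthonormal_def)
    have "\<forall>y\<in>D. (\<Sum>z\<in>D. (g (m (A y)) z - g (m (A z)) y)\<^sup>2) = 0"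
      using that(1) by (subst sum_nonneg_eq_0_iff[symmetric, OF fin]) (auto intro: sum_nonneg)
    then have "\<forall>z\<in>D. (g (m (A y)) z - g (m (A z)) y)\<^sup>2 = 0"
      using that(2) by (subst sum_nonneg_eq_0_iff[symmetric, OF fin]) auto
    then show ?thesis using that(3) by simp
  qed

  have cHHH: "c x y z = 0" if "x \<in> D" "y \<in> D" "z \<in> D" for x y z
    using that by (simp add: c_eq abelian A_H D_H g_simps)
  have ceHH: "c e y z = 0" "c f y z = 0" if "y \<in> D" "z \<in> D" for y z
    using that sym[OF S0(1) that] sym[OF S0(2) that] by (simp_all add: c_e c_f D_H)
  have cefH: "c e f z = 0" if "z \<in> D" for z using c_efH[OF D_H[OF that]] w0 by (simp add: g_simps)
  have c_rep: "c x x z = 0" for x z using c_skew[of x x z] by simp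
  have "c x y z = 0" if "x \<in> insert e (insert f D)" "y \<in> insert e (insert f D)" "z \<in> insert e (insert f D)" for x y z
    using that cHHH ceHH cefH c_rep c_cyclic c_skew by (smt (verit) insertE)
  note on_frame = this
  have UN: "span (insert e (insert f D)) = UNIV" using UN by (simp add: f_def)
  have "c x y z = 0" if "x \<in> insert e (insert f D)" "y \<in> insert e (insert f D)" for x y z
    using linear_eq_0_on_span[OF c_linear3 on_frame[OF that]] UN by blast
  then have "c x y z = 0" if "x \<in> insert e (insert f D)" for x y z
    using linear_eq_0_on_span[OF c_linear2, of "insert e (insert f D)"] that UN by blast
  then have c0: "c x y z = 0" for x y z
    using linear_eq_0_on_span[OF c_linear1, of "insert e (insert f D)"] UN by blast
  have "ce_diff br (fundamental_form A g) [x, y, z] = c (- A x) (- A y) (- A z)" for x y z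
    by (simp add: c_def bismut_torsion_def A_simps hermitianD(2)[OF HA])
  then show ?thesis using HA c0 by (simp add: kahler_structure_def)
qed

end

lemma kahler_imp_generalized_kahler:
  assumes "kahler_structure br J g"
  shows "generalized_kahler_structure br J J g"
proof -
  have "bismut_torsion br J g [x, y, z] = 0" for x y z
    using assms by (simp add: kahler_structure_def bismut_torsion_def)
  then show ?thesis
    using assms by (simp add: kahler_structure_def generalized_kahler_structure_def ce_diff_3_form)
qed

theorem theorem2p4:
  fixes br :: "'a::real_vector \<Rightarrow> 'a \<Rightarrow> 'a" and H :: "'a set"
  assumes "\<exists>B::'a set. finite B \<and> span B = UNIV"
    and "lie_bracket br"
    and "solvable_on br UNIV"
    and "is_nilradical br H"
    and "dim (UNIV :: 'a set) = dim H + 2"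
  shows "(\<exists>Jp Jm g. generalized_kahler_structure br Jp Jm g \<and> Jp ` H = H \<and> Jm ` H = H)
     \<longleftrightarrow> (\<exists>J g. kahler_structure br J g \<and> J ` H = H)"
proof
  assume "\<exists>Jp Jm g. generalized_kahler_structure br Jp Jm g \<and> Jp ` H = H \<and> Jm ` H = H"
  then obtain Jp Jm g where gk: "generalized_kahler_structure br Jp Jm g"
    and inv: "Jp ` H = H" "Jm ` H = H" by blast
  have ip: "inner_product g"
    using gk by (auto simp: generalized_kahler_structure_def hermitian_structure_def)
  obtain B :: "'a set" where "finite B" "span B = UNIV" using assms(1) by blast
  then obtain E where "orthonormal g E" "span E = UNIV"
    using orthonormal_extend[OF ip, of "{}" B] by (auto simp: orthonormal_def)
  then interpret gk_lie_algebra br Jp Jm g E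
    using assms(2) gk by unfold_locales
  have "kahler_structure br Jp g" by (rule kahler_of_codim_2[OF assms(4) inv assms(5)])
  then show "\<exists>J g. kahler_structure br J g \<and> J ` H = H" using inv(1) by blast
next
  assume "\<exists>J g. kahler_structure br J g \<and> J ` H = H"
  then show "\<exists>Jp Jm g. generalized_kahler_structure br Jp Jm g \<and> Jp ` H = H \<and> Jm ` H = H"
    using kahler_imp_generalized_kahler by blast
qed

end
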